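(* Let $M\in\mathbb{R}^{N\times N}$ be symmetric positive definite, let $K_0,K\in\mathbb{R}^{N\times N}$ be symmetric, and let $\lambda_1\le\cdots\le\lambda_N$ be the generalized eigenvalues of $(K_0,M)$. Suppose the discretization has $k$ outliers, separated by $$\gamma:=\lambda_{N-k+1}-\lambda_{N-k}>0.$$ Either of the following implies that the $k$ largest generalized eigenvalues of $(K,M)$ are separated from the remaining $N-k$ by a positive gap, so that the cutoff $\omega_c$ selects exactly $k$ modes. (i) $2\varepsilon<\gamma$, where $\varepsilon:=\bigl\|M^{-1/2}(K-K_0)M^{-1/2}\bigr\|_2$. (ii) There exist $\sigma_-\le\sigma_+$ with $$(1+\sigma_-)\,x^{\top}K_0x\;\le\;x^{\top}Kx\;\le\;(1+\sigma_+)\,x^{\top}K_0x\qquad\text{for all }x,$$ and $\dfrac{1+\sigma_+}{1+\sigma_-}<\dfrac{\lambda_{N-k+1}}{\lambda_{N-k}}$. Under (i) the largest principal angle $\vartheta$ between the $k$-dimensional outlier eigenspaces of $(K,M)$ and of $(K_0,M)$ (the largest of the canonical angles between those subspaces) obeys $\sin\vartheta\le\varepsilon/(\gamma-\varepsilon)$.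
   Context: Generalized eigenvalues of a pencil $(K,M)$ are the $\mu$ with $Kx=\mu Mx$ for some $x\neq0$, counted with multiplicity. The integer $k$ (with $1\le k<N$) is the outlier count of the spatial discretization: the outliers are the $k$ modes with the largest generalized eigenvalues, and the outlier eigenspace of a pencil is the span of the generalized eigenvectors belonging to its $k$ largest generalized eigenvalues. Principal (canonical) angles are taken in the $M$-inner product $x^\top My$; equivalently, they are the Euclidean principal angles between the corresponding eigenspaces of $M^{-1/2}KM^{-1/2}$ and $M^{-1/2}K_0M^{-1/2}$. The setting is an undamped second-order system $M\ddot q+f_{\mathrm{int}}(q)=0$ with tangent stiffness $K=K(q)=\partial f_{\mathrm{int}}/\partial q$ and reference stiffness $K_0$. The first-order (state-space) Jacobian $J$ of the system has purely imaginary eigenvalues $\pm i\omega_j$, where $\omega_j^2$ are the generalized eigenvalues of $(K,M)$, ordered $0\le\omega_1\le\cdots\le\omega_N$. With step size $h>0$, the cutoff for this system is $\omega_c=h\,\omega_{N-k+1}$, and it selects the modes with $h\omega_j\ge\omega_c$.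
   Formalization: In (ii) the condition 1+σ_- > 0 is added; without it the claim fails (M=I, K_0=diag(1,3), K=0, k=1, σ_-=-2, σ_+=0). The ratio λ_{N-k+1}/λ_{N-k} is read as +∞ when λ_{N-k}=0. *)

theory Defs
  imports "HOL-Analysis.Analysis" "HOL-Library.Multiset" "HOL-Library.Extended_Real"
begin

definition symmetric_matrix :: "real^'n^'n \<Rightarrow> bool" where
  "symmetric_matrix A \<longleftrightarrow> transpose A = A"

definition spd_matrix :: "real^'n^'n \<Rightarrow> bool" where
  "spd_matrix A \<longleftrightarrow> symmetric_matrix A \<and> (\<forall>x. x \<noteq> 0 \<longrightarrow> 0 < x \<bullet> (A *v x))"

(* M^(-1/2): the unique symmetric positive definite square root of the inverse. *)
definition inv_sqrt_matrix :: "real^'n^'n \<Rightarrow> real^'n^'n" where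
  "inv_sqrt_matrix M = (THE S. spd_matrix S \<and> S ** S = matrix_inv M)"

(* norm on real^'n is Euclidean, so onorm is the induced spectral norm. *)
definition spectral_norm :: "real^'n^'n \<Rightarrow> real" where
  "spectral_norm A = onorm (\<lambda>x. A *v x)"

definition gen_eigenspace :: "real^'n^'n \<Rightarrow> real^'n^'n \<Rightarrow> real \<Rightarrow> (real^'n) set" where
  "gen_eigenspace K M \<mu> = {x. K *v x = \<mu> *\<^sub>R (M *v x)}"

definition is_gen_eigenvalue :: "real^'n^'n \<Rightarrow> real^'n^'n \<Rightarrow> real \<Rightarrow> bool" where
  "is_gen_eigenvalue K M \<mu> \<longleftrightarrow> (\<exists>x. x \<noteq> 0 \<and> K *v x = \<mu> *\<^sub>R (M *v x))"

(* Multiplicity is the dimension of the eigenspace; for K symmetric and M symmetric positive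
   definite it equals the multiplicity as a root of det (K - mu M), so there are exactly
   CARD('n) entries.  Meaningful only for pencils with finitely many eigenvalues. *)
definition gen_eigenvalues :: "real^'n^'n \<Rightarrow> real^'n^'n \<Rightarrow> real multiset" where
  "gen_eigenvalues K M =
     (\<Sum>\<mu> | is_gen_eigenvalue K M \<mu>. replicate_mset (dim (gen_eigenspace K M \<mu>)) \<mu>)"

(* The j-th smallest generalized eigenvalue, j = 1, ..., CARD('n). *)
definition gen_eigenvalue :: "real^'n^'n \<Rightarrow> real^'n^'n \<Rightarrow> nat \<Rightarrow> real" where
  "gen_eigenvalue K M j = sorted_list_of_multiset (gen_eigenvalues K M) ! (j - 1)"

definition outlier_eigenspace :: "real^'n^'n \<Rightarrow> real^'n^'n \<Rightarrow> nat \<Rightarrow> (real^'n) set" where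
  "outlier_eigenspace K M k =
     span (\<Union>j\<in>{CARD('n) - k + 1..CARD('n)}. gen_eigenspace K M (gen_eigenvalue K M j))"

definition m_inner :: "real^'n^'n \<Rightarrow> real^'n \<Rightarrow> real^'n \<Rightarrow> real" where
  "m_inner M x y = x \<bullet> (M *v y)"

(* Candidates for the i-th pair of principal vectors, given the earlier pairs
   (u j, v j), 1 <= j < i. *)
definition principal_candidate ::
    "real^'n^'n \<Rightarrow> (real^'n) set \<Rightarrow> (real^'n) set \<Rightarrow> (nat \<Rightarrow> real^'n) \<Rightarrow> (nat \<Rightarrow> real^'n)
     \<Rightarrow> nat \<Rightarrow> real^'n \<Rightarrow> real^'n \<Rightarrow> bool" where
  "principal_candidate M U V u v i x y \<longleftrightarrow>
     x \<in> U \<and> y \<in> V \<and> m_inner M x x = 1 \<and> m_inner M y y = 1 \<and>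
     (\<forall>j\<in>{1..<i}. m_inner M (u j) x = 0 \<and> m_inner M (v j) y = 0)"

(* The usual recursive definition: the i-th pair maximizes the M-inner product. *)
definition principal_vectors ::
    "real^'n^'n \<Rightarrow> (real^'n) set \<Rightarrow> (real^'n) set \<Rightarrow> (nat \<Rightarrow> real^'n) \<Rightarrow> (nat \<Rightarrow> real^'n) \<Rightarrow> bool" where
  "principal_vectors M U V u v \<longleftrightarrow>
     (\<forall>i\<in>{1..min (dim U) (dim V)}.
        principal_candidate M U V u v i (u i) (v i) \<and>
        (\<forall>x y. principal_candidate M U V u v i x y \<longrightarrow> m_inner M x y \<le> m_inner M (u i) (v i)))"

(* The angles do not depend on the choice of the principal vectors. *)
definition canonical_angles ::
    "real^'n^'n \<Rightarrow> (real^'n) set \<Rightarrow> (real^'n) set \<Rightarrow> real set" where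
  "canonical_angles M U V =
     {arccos (m_inner M (u i) (v i)) | u v i.
        principal_vectors M U V u v \<and> i \<in> {1..min (dim U) (dim V)}}"

definition largest_principal_angle ::
    "real^'n^'n \<Rightarrow> (real^'n) set \<Rightarrow> (real^'n) set \<Rightarrow> real" where
  "largest_principal_angle M U V = Max (canonical_angles M U V)"

(* om j is the frequency of mode j; the modes are indexed by 1, ..., N. *)
definition cutoff :: "real \<Rightarrow> (nat \<Rightarrow> real) \<Rightarrow> nat \<Rightarrow> nat \<Rightarrow> real" where
  "cutoff h om N k = h * om (N - k + 1)"

definition selected_modes :: "real \<Rightarrow> (nat \<Rightarrow> real) \<Rightarrow> nat \<Rightarrow> real \<Rightarrow> nat set" where
  "selected_modes h om N c = {j \<in> {1..N}. c \<le> h * om j}"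

(* (1 + sp) / (1 + sm) < l1 / l0 presupposes 1 + sm > 0: for 1 + sm < 0 < 1 + sp the
   quotient is negative and the bounds even allow K = 0.  The right-hand quotient is taken in the
   extended reals, so that it is infinite for l0 = 0 < l1 (in type real it would be 0). *)
definition relative_bound :: 
    "real^'n^'n \<Rightarrow> real^'n^'n \<Rightarrow> real \<Rightarrow> real \<Rightarrow> real \<Rightarrow> real \<Rightarrow> bool" where
  "relative_bound K0 K l0 l1 sm sp \<longleftrightarrow>
     -1 < sm \<and> sm \<le> sp \<and>
     (\<forall>x. (1 + sm) * (x \<bullet> (K0 *v x)) \<le> x \<bullet> (K *v x) \<and>
          x \<bullet> (K *v x) \<le> (1 + sp) * (x \<bullet> (K0 *v x))) \<and>
     ereal ((1 + sp) / (1 + sm)) < ereal l1 / ereal l0"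

end

theory Submission imports Defs begin

text \<open>
  A pencil \<open>(K, M)\<close> has an \<open>M\<close>-orthonormal basis of eigenvectors, obtained by successive
  minimization of the Rayleigh quotient. A dimension count yields a unit vector on which the forms of
  \<open>K\<close> and \<open>K0\<close> compare the \<open>j\<close>-th eigenvalues of both pencils; this gives Weyl's inequality
  \<open>\<bar>\<mu>\<^sub>j - \<lambda>\<^sub>j\<bar> \<le> \<epsilon>\<close> and its relative analogue, and hence the gap. By maximality, principal
  vectors \<open>u\<close>, \<open>v\<close> with \<open>cos \<theta> = \<sigma>\<close> project to \<open>\<sigma> v\<close> and \<open>\<sigma> u\<close> on the opposite
  subspace. For \<open>w = u - \<sigma> v\<close>, of squared \<open>M\<close>-norm \<open>sin\<^sup>2 \<theta>\<close>, the number
  \<open>w \<bullet> (K - K0) u\<close> is at most \<open>\<epsilon> sin \<theta>\<close> and at least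
  \<open>(\<mu>\<^sub>N\<^sub>-\<^sub>k\<^sub>+\<^sub>1 - \<lambda>\<^sub>N\<^sub>-\<^sub>k) sin\<^sup>2 \<theta>\<close>.
\<close>

section \<open>Auxiliary facts from linear algebra and calculus\<close>

lemma symmetric_matrix_dot:
  assumes "symmetric_matrix A"
  shows "x \<bullet> (A *v y) = (A *v x) \<bullet> y"
  using assms unfolding symmetric_matrix_def
  by (metis dot_lmul_matrix transpose_matrix_vector)

text \<open>The orthogonal complement \<open>T\<close> of \<open>span A\<close> has dimension at
  least \<open>DIM('a) - card A\<close>, so \<open>dim U + dim T\<close> exceeds the ambient
  dimension and \<open>U\<close> meets \<open>T\<close> outside \<open>0\<close>.\<close>

lemma exists_nonzero_orthogonal_in_subspace:
  fixes U :: "'a::euclidean_space set"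
  assumes U: "subspace U" and A: "finite A" "card A < dim U"
  obtains x where "x \<in> U" "x \<noteq> 0" "\<And>a. a \<in> A \<Longrightarrow> a \<bullet> x = 0"
proof -
  define T where "T = {y. \<forall>x \<in> span A. orthogonal x y}"
  have T: "subspace T"
    unfolding T_def subspace_def orthogonal_def by (auto simp: inner_right_distrib)
  have "dim T + dim (span A) = DIM('a)"
    using dim_subspace_orthogonal_to_vectors[of "span A" UNIV] by (simp add: T_def)
  moreover have "dim (span A) \<le> card A"
    using dim_le_card'[OF A(1)] by simp
  moreover have "dim {x + y |x y. x \<in> U \<and> y \<in> T} + dim (U \<inter> T) = dim U + dim T"
    by (rule dim_sums_Int[OF U T])
  moreover have "dim {x + y |x y. x \<in> U \<and> y \<in> T} \<le> DIM('a)"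
    by (rule dim_subset_UNIV)
  ultimately have "dim (U \<inter> T) \<noteq> 0"
    using A(2) by linarith
  then obtain x where x: "x \<in> U" "x \<in> T" "x \<noteq> 0"
    by (auto simp: dim_eq_0)
  show ?thesis
    using x by (intro that[of x]) (auto simp: T_def orthogonal_def span_base)
qed

text \<open>The first-order condition at a minimum: near \<open>t = 0\<close> the linear term
  outweighs the quadratic one.\<close>

lemma linear_coeff_zero_if_quadratic_nonneg:
  fixes b q :: real
  assumes "\<And>t. 0 \<le> 2 * t * b + t\<^sup>2 * q"
  shows "b = 0"
proof (rule ccontr)
  assume b: "b \<noteq> 0"
  \<comment> \<open>\<open>c\<close> is positive and exceeds \<open>q\<close> whatever the sign of
    \<open>q\<close>, so \<open>t = - b / c\<close> makes the expression negative.\<close>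
  define c where "c = \<bar>q\<bar> + 1"
  have c: "c > 0" "q < c" by (auto simp: c_def)
  have "2 * (- b / c) * b + (- b / c)\<^sup>2 * q = (b / c)\<^sup>2 * (q - 2 * c)"
    using c by (simp add: field_simps power2_eq_square)
  also have "\<dots> < 0"
    using b c by (intro mult_pos_neg) auto
  finally show False
    using assms[of "- b / c"] by linarith
qed

section \<open>Geometry of the inner product given by \<open>M\<close>\<close>

locale spd_form =
  fixes M :: "real^'n^'n"
  assumes spd: "spd_matrix M"
begin

abbreviation ip :: "real^'n \<Rightarrow> real^'n \<Rightarrow> real" where "ip \<equiv> m_inner M"

lemma symmetric: "symmetric_matrix M"
  using spd by (simp add: spd_matrix_def)

lemma ip_commute: "ip x y = ip y x"
  unfolding m_inner_def by (metis inner_commute symmetric symmetric_matrix_dot)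

lemma ip_left: "ip x y = (M *v x) \<bullet> y"
  unfolding m_inner_def by (rule symmetric_matrix_dot[OF symmetric])

lemma ip_simps [simp]:
  "ip (x + y) z = ip x z + ip y z" "ip x (y + z) = ip x y + ip x z"
  "ip (x - y) z = ip x z - ip y z" "ip x (y - z) = ip x y - ip x z"
  "ip (c *\<^sub>R x) z = c * ip x z" "ip x (c *\<^sub>R z) = c * ip x z"
  "ip 0 x = 0" "ip x 0 = 0" "ip (- x) z = - ip x z" "ip x (- z) = - ip x z"
  unfolding ip_left
  by (simp_all add: inner_left_distrib inner_right_distrib inner_diff_left inner_diff_right
      matrix_vector_right_distrib matrix_vector_mult_diff_distrib matrix_vector_mult_scaleR
      scaleR_right.minus linear_neg[OF matrix_vector_mul_linear])

lemma ip_sum_right: "ip x (\<Sum>i\<in>I. f i) = (\<Sum>i\<in>I. ip x (f i))"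
  by (simp add: ip_left inner_sum_right)

lemma ip_pos: "x \<noteq> 0 \<Longrightarrow> 0 < ip x x"
  using spd by (simp add: spd_matrix_def m_inner_def)

lemma ip_nonneg: "0 \<le> ip x x"
  using ip_pos[of x] by (cases "x = 0") auto

lemma ip_eq_0_iff [simp]: "ip x x = 0 \<longleftrightarrow> x = 0"
proof
  assume "ip x x = 0"
  then show "x = 0" using ip_pos[of x] by (metis less_irrefl)
qed simp

lemma ip_normalize:
  assumes "x \<noteq> 0"
  shows "ip ((1 / sqrt (ip x x)) *\<^sub>R x) ((1 / sqrt (ip x x)) *\<^sub>R x) = 1"
  using ip_pos[OF assms] assms by simp

lemma continuous_on_ip [continuous_intros]:
  "continuous_on A f \<Longrightarrow> continuous_on A g \<Longrightarrow> continuous_on A (\<lambda>x. ip (f x) (g x))"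
  unfolding m_inner_def
  by (intro continuous_on_inner bounded_linear.continuous_on[OF matrix_vector_mul_bounded_linear])

text \<open>The form has a positive minimum \<open>c\<close> on the Euclidean unit sphere; by
  homogeneity its own unit sphere lies in the ball of radius \<open>1 / sqrt c\<close>.\<close>

lemma compact_ip_sphere: "compact {x. ip x x = 1}"
proof -
  have "\<exists>c>0. \<forall>x. norm x = 1 \<longrightarrow> c \<le> ip x x"
  proof -
    have "compact (sphere (0::real^'n) 1)" "sphere (0::real^'n) 1 \<noteq> {}"
      by simp_all
    moreover have "continuous_on (sphere (0::real^'n) 1) (\<lambda>x. ip x x)"
      by (intro continuous_on_ip continuous_on_id)
    ultimately have "\<exists>z\<in>sphere 0 1. \<forall>x\<in>sphere 0 1. ip z z \<le> ip x x"
      by (rule continuous_attains_inf)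
    then obtain z where z: "z \<in> sphere 0 1" "\<forall>x\<in>sphere 0 1. ip z z \<le> ip x x"
      by blast
    then have "0 < ip z z" by (intro ip_pos) auto
    with z(2) show ?thesis by auto
  qed
  then obtain c where c: "c > 0" "\<And>x. norm x = 1 \<Longrightarrow> c \<le> ip x x"
    by blast
  have "norm x \<le> 1 / sqrt c" if "ip x x = 1" for x
  proof -
    have x: "x \<noteq> 0" using that by auto
    then have "c \<le> ip ((1 / norm x) *\<^sub>R x) ((1 / norm x) *\<^sub>R x)"
      by (intro c) simp
    also have "\<dots> = 1 / (norm x)\<^sup>2"
      using that by (simp add: power2_eq_square)
    finally have "(norm x)\<^sup>2 \<le> 1 / c"
      using x c by (simp add: field_simps)
    then show ?thesis
      by (metis real_le_rsqrt real_sqrt_divide real_sqrt_one)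
  qed
  then have "bounded {x. ip x x = 1}"
    by (auto simp: bounded_iff)
  moreover have "closed {x. ip x x = 1}"
    by (intro closed_Collect_eq continuous_on_ip continuous_on_id continuous_on_const)
  ultimately show ?thesis
    by (simp add: compact_eq_bounded_closed)
qed

text \<open>\<open>M\<close>-orthogonality to \<open>e i\<close> is Euclidean orthogonality to
  \<open>M *v e i\<close>, which reduces this to the dimension count. The index type is arbitrary,
  so that two bases can be merged into one family of constraints.\<close>

lemma unit_orthogonal_in_subspace:
  assumes "subspace U" "finite I" "card I < dim U"
  obtains x where "x \<in> U" "ip x x = 1" "\<And>i. i \<in> I \<Longrightarrow> ip (e i) x = 0"
proof -
  have "card ((\<lambda>i. M *v e i) ` I) < dim U"
    using assms card_image_le le_less_trans by blast
  then obtain x where x: "x \<in> U" "x \<noteq> 0" "\<And>a. a \<in> (\<lambda>i. M *v e i) ` I \<Longrightarrow> a \<bullet> x = 0"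
    using exists_nonzero_orthogonal_in_subspace[OF assms(1) finite_imageI[OF assms(2)]] by metis
  show ?thesis
  proof (rule that[of "(1 / sqrt (ip x x)) *\<^sub>R x"])
    show "(1 / sqrt (ip x x)) *\<^sub>R x \<in> U"
      using x assms(1) by (simp add: subspace_scale)
    show "ip ((1 / sqrt (ip x x)) *\<^sub>R x) ((1 / sqrt (ip x x)) *\<^sub>R x) = 1"
      by (rule ip_normalize[OF x(2)])
    show "ip (e i) ((1 / sqrt (ip x x)) *\<^sub>R x) = 0" if "i \<in> I" for i
      using x(3)[of "M *v e i"] that by (simp add: ip_left)
  qed
qed

lemma ip_orthogonal_independent:
  assumes "\<And>a b. a \<in> S \<Longrightarrow> b \<in> S \<Longrightarrow> a \<noteq> b \<Longrightarrow> ip a b = 0" "0 \<notin> S"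
  shows "independent S"
  unfolding dependent_def
proof clarify
  fix a assume a: "a \<in> S" "a \<in> span (S - {a})"
  have "ip a x = 0" if "x \<in> span (S - {a})" for x
    using that
  proof (induction rule: span_induct)
    case base
    show ?case by (simp add: subspace_def)
  next
    case (step x)
    then show ?case using assms a by auto
  qed
  from this[OF a(2)] a(1) assms(2) show False by auto
qed

definition orthonormal_on :: "'i set \<Rightarrow> ('i \<Rightarrow> real^'n) \<Rightarrow> bool" where
  "orthonormal_on I e \<longleftrightarrow> (\<forall>i\<in>I. \<forall>j\<in>I. ip (e i) (e j) = (if i = j then 1 else 0))"

lemma orthonormal_onD:
  "orthonormal_on I e \<Longrightarrow> i \<in> I \<Longrightarrow> j \<in> I \<Longrightarrow> ip (e i) (e j) = (if i = j then 1 else 0)"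
  by (simp add: orthonormal_on_def)

lemma orthonormal_on_subset: "orthonormal_on I e \<Longrightarrow> J \<subseteq> I \<Longrightarrow> orthonormal_on J e"
  unfolding orthonormal_on_def by blast

lemma orthonormal_inj_on: "orthonormal_on I e \<Longrightarrow> inj_on e I"
  by (rule inj_onI) (metis orthonormal_onD zero_neq_one)

lemma orthonormal_independent: "orthonormal_on I e \<Longrightarrow> independent (e ` I)"
  by (rule ip_orthogonal_independent) (force simp: orthonormal_on_def split: if_splits)+

lemma ip_Gram_Schmidt:
  assumes e: "orthonormal_on J e" "finite J" and U: "subspace U" "e ` J \<subseteq> U" and x: "x \<in> U"
  obtains y where "y \<in> U" "\<And>j. j \<in> J \<Longrightarrow> ip (e j) y = 0" "x = y + (\<Sum>j\<in>J. ip (e j) x *\<^sub>R e j)"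
proof (rule that[of "x - (\<Sum>j\<in>J. ip (e j) x *\<^sub>R e j)"])
  show "x - (\<Sum>j\<in>J. ip (e j) x *\<^sub>R e j) \<in> U"
    using U x by (intro subspace_diff subspace_sum subspace_scale) auto
  fix i assume i: "i \<in> J"
  have "ip (e i) (\<Sum>j\<in>J. ip (e j) x *\<^sub>R e j) = (\<Sum>j\<in>J. if i = j then ip (e j) x else 0)"
    unfolding ip_sum_right using e i by (intro sum.cong) (auto simp: orthonormal_onD)
  then show "ip (e i) (x - (\<Sum>j\<in>J. ip (e j) x *\<^sub>R e j)) = 0"
    using i e by simp
qed simp

text \<open>The Gram-Schmidt remainder \<open>y\<close> vanishes; otherwise it would extend the
  family to \<open>dim U + 1\<close> independent vectors in \<open>U\<close>.\<close>

lemma orthonormal_expansion: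
  assumes e: "orthonormal_on I e" "finite I" and U: "subspace U" "e ` I \<subseteq> U" "card I = dim U"
    and x: "x \<in> U"
  shows "x = (\<Sum>i\<in>I. ip (e i) x *\<^sub>R e i)"
proof -
  obtain y where y: "y \<in> U" and orth: "\<And>i. i \<in> I \<Longrightarrow> ip (e i) y = 0"
      and xy: "x = y + (\<Sum>i\<in>I. ip (e i) x *\<^sub>R e i)"
    using ip_Gram_Schmidt[OF e U(1,2) x] by blast
  have "y = 0"
  proof (rule ccontr)
    assume y0: "y \<noteq> 0"
    have "independent (insert y (e ` I))"
    proof (rule ip_orthogonal_independent)
      show "0 \<notin> insert y (e ` I)"
        using y0 e by (force simp: orthonormal_on_def)
      show "ip a b = 0" if "a \<in> insert y (e ` I)" "b \<in> insert y (e ` I)" "a \<noteq> b" for a b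
        using that orth e by (auto simp: ip_commute[of y] orthonormal_onD split: if_splits)
    qed
    then have "card (insert y (e ` I)) \<le> dim U"
      using y U by (intro independent_card_le_dim) auto
    moreover have "y \<notin> e ` I"
      using orth y0 by (metis imageE ip_eq_0_iff)
    ultimately show False
      using U e card_image[OF orthonormal_inj_on[OF e(1)]] by simp
  qed
  with xy show ?thesis by simp
qed

text \<open>If some \<open>y\<close> in \<open>W\<close> orthogonal to \<open>u\<close> had
  \<open>ip y v \<noteq> 0\<close>, tilting \<open>u\<close> along \<open>y\<close> would increase
  the functional. This turns maximality of principal vectors into a linear identity.\<close>

lemma ip_unit_maximizer:
  assumes W: "subspace W" and u: "u \<in> W" "ip u u = 1"
    and max: "\<And>x. x \<in> W \<Longrightarrow> ip x x = 1 \<Longrightarrow> ip x v \<le> ip u v" and x: "x \<in> W"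
  shows "ip x v = ip u v * ip x u"
proof (rule ccontr)
  define y where "y = x - ip x u *\<^sub>R u"
  assume "ip x v \<noteq> ip u v * ip x u"
  then have yv: "ip y v \<noteq> 0" by (simp add: y_def mult.commute)
  have y: "y \<in> W" "ip y u = 0"
    using W u x by (auto simp: y_def intro: subspace_diff subspace_scale)
  define z where "z = (1 / sqrt (ip y y)) *\<^sub>R y"
  have y0: "y \<noteq> 0" using yv by auto
  have z: "z \<in> W" "ip z u = 0" "ip z v \<noteq> 0" "ip z z = 1"
    subgoal using y W by (simp add: z_def subspace_scale)
    subgoal using y by (simp add: z_def)
    subgoal using y0 yv by (simp add: z_def)
    subgoal unfolding z_def by (rule ip_normalize[OF y0])
    done
  define r where "r = sqrt ((ip u v)\<^sup>2 + (ip z v)\<^sup>2)"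
  have r2: "r\<^sup>2 = (ip u v)\<^sup>2 + (ip z v)\<^sup>2" and r: "r > 0"
    using z by (auto simp: r_def sum_power2_gt_zero_iff)
  \<comment> \<open>\<open>p\<close> is the unit vector along the projection of \<open>v\<close>
    onto the plane of \<open>u\<close> and \<open>z\<close>; the functional takes the value
    \<open>r > ip u v\<close> there.\<close>
  define p where "p = (ip u v / r) *\<^sub>R u + (ip z v / r) *\<^sub>R z"
  have "ip p p = ((ip u v)\<^sup>2 + (ip z v)\<^sup>2) / r\<^sup>2"
    using z u by (simp add: p_def ip_commute[of u z] power2_eq_square add_divide_distrib)
  then have "ip p p = 1" using r by (simp add: r2[symmetric])
  moreover have "p \<in> W"
    using W z u by (auto simp: p_def intro!: subspace_add subspace_scale)
  ultimately have "ip p v \<le> ip u v" by (rule max[rotated])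
  moreover have "ip p v = ((ip u v)\<^sup>2 + (ip z v)\<^sup>2) / r"
    by (simp add: p_def power2_eq_square add_divide_distrib)
  then have "ip p v = r"
    using r unfolding r2[symmetric] by (simp add: power2_eq_square)
  ultimately have "r \<le> ip u v" by simp
  then have "r\<^sup>2 \<le> (ip u v)\<^sup>2"
    using r by (intro power_mono) auto
  then show False using r2 z by simp
qed

lemma subspace_ip_orthogonal:
  "subspace U \<Longrightarrow> subspace {x \<in> U. \<forall>j\<in>J. ip (e j) x = 0}"
  by (auto simp: subspace_def)

section \<open>Eigenbases of a symmetric pencil\<close>

definition eigenbasis :: "real^'n^'n \<Rightarrow> (nat \<Rightarrow> real^'n) \<Rightarrow> (nat \<Rightarrow> real) \<Rightarrow> bool" where
  "eigenbasis K e \<nu> \<longleftrightarrow>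
     orthonormal_on {1..CARD('n)} e \<and>
     (\<forall>i\<in>{1..CARD('n)}. K *v e i = \<nu> i *\<^sub>R (M *v e i)) \<and>
     mono_on {1..CARD('n)} \<nu>"

text \<open>By scaling, \<open>z \<bullet> (K *v z) - \<nu> * ip z z\<close> is nonnegative on all
  of \<open>W\<close>, and it vanishes at \<open>x\<close>; hence its derivative at \<open>x\<close>
  along \<open>y\<close> is zero.\<close>

lemma Rayleigh_minimizer_stationary:
  assumes K: "symmetric_matrix K" and W: "subspace W" and x: "x \<in> W" "ip x x = 1"
    and min: "\<And>y. y \<in> W \<Longrightarrow> ip y y = 1 \<Longrightarrow> x \<bullet> (K *v x) \<le> y \<bullet> (K *v y)"
    and y: "y \<in> W"
  shows "y \<bullet> (K *v x - (x \<bullet> (K *v x)) *\<^sub>R (M *v x)) = 0"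
proof -
  define \<nu> where "\<nu> = x \<bullet> (K *v x)"
  have q: "0 \<le> z \<bullet> (K *v z) - \<nu> * ip z z" if "z \<in> W" for z
  proof (cases "z = 0")
    case False
    let ?c = "1 / sqrt (ip z z)"
    have "\<nu> \<le> (?c *\<^sub>R z) \<bullet> (K *v (?c *\<^sub>R z))"
      unfolding \<nu>_def using that W False
      by (intro min ip_normalize subspace_scale) auto
    also have "\<dots> = (z \<bullet> (K *v z)) / ip z z"
      using ip_pos[OF False] by (simp add: matrix_vector_mult_scaleR)
    finally show ?thesis
      using ip_pos[OF False] by (simp add: field_simps)
  qed auto
  have sym: "x \<bullet> (K *v y) = y \<bullet> (K *v x)"
    by (metis K inner_commute symmetric_matrix_dot)
  define b where "b = y \<bullet> (K *v x) - \<nu> * ip y x"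
  have "b = 0"
  proof (rule linear_coeff_zero_if_quadratic_nonneg)
    fix t
    have "0 \<le> (x + t *\<^sub>R y) \<bullet> (K *v (x + t *\<^sub>R y)) - \<nu> * ip (x + t *\<^sub>R y) (x + t *\<^sub>R y)"
      using W x y by (intro q subspace_add subspace_scale)
    also have "\<dots> = 2 * t * b + t\<^sup>2 * (y \<bullet> (K *v y) - \<nu> * ip y y)"
      using x(2) sym by (simp add: matrix_vector_mult_scaleR matrix_vector_right_distrib b_def
          inner_add_left inner_add_right ip_commute[of x y] \<nu>_def[symmetric] algebra_simps power2_eq_square)
    finally show "0 \<le> 2 * t * b + t\<^sup>2 * (y \<bullet> (K *v y) - \<nu> * ip y y)" .
  qed
  then show ?thesis
    by (simp add: b_def \<nu>_def m_inner_def inner_diff_right)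
qed

text \<open>Each vector minimizes the Rayleigh quotient on the \<open>M\<close>-complement of the
  earlier ones. Its residual is orthogonal to that complement by stationarity and to the earlier
  vectors by symmetry of \<open>K\<close>, hence zero.\<close>

lemma eigenbasis_exists:
  assumes K: "symmetric_matrix K"
  obtains e \<nu> where "eigenbasis K e \<nu>"
proof -
  let ?N = "CARD('n)"
  define W where "W e i = {x. \<forall>j\<in>{1..<i}. ip (e j) x = 0}" for e :: "nat \<Rightarrow> real^'n" and i :: nat
  have W: "subspace (W e i)" for e i
    using subspace_ip_orthogonal[of UNIV "{1..<i}" e] by (simp add: W_def)
  \<comment> \<open>Outside \<open>{1..?N}\<close> the predicate is vacuous, so a total sequence can
    be chosen recursively; \<open>P e i\<close> looks at \<open>e\<close> only below
    \<open>i\<close>.\<close>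
  define P where "P e i x \<longleftrightarrow> (i \<in> {1..?N} \<longrightarrow> x \<in> W e i \<and> ip x x = 1 \<and>
      (\<forall>y\<in>W e i. ip y y = 1 \<longrightarrow> x \<bullet> (K *v x) \<le> y \<bullet> (K *v y)))"
    for e :: "nat \<Rightarrow> real^'n" and i :: nat and x
  have "\<exists>e. \<forall>i. P e i (e i)"
  proof (rule dependent_wellorder_choice)
    fix r i and e e' :: "nat \<Rightarrow> real^'n"
    assume "\<And>j. j < i \<Longrightarrow> e j = e' j"
    then have "W e i = W e' i" by (simp add: W_def)
    then show "P e i r = P e' i r" by (simp add: P_def)
  next
    fix i and e :: "nat \<Rightarrow> real^'n"
    show "\<exists>x. P e i x"
    proof (cases "i \<in> {1..?N}")
      case True
      let ?S = "{x. ip x x = 1} \<inter> W e i"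
      have "compact ?S"
        by (intro compact_Int_closed compact_ip_sphere closed_subspace W)
      moreover have "?S \<noteq> {}"
      proof -
        obtain x where "ip x x = 1" "\<And>j. j \<in> {1..<i} \<Longrightarrow> ip (e j) x = 0"
          by (rule unit_orthogonal_in_subspace[of UNIV "{1..<i}" e]) (use True in auto)
        then show ?thesis by (auto simp: W_def)
      qed
      moreover have "continuous_on ?S (\<lambda>x. x \<bullet> (K *v x))"
        by (intro continuous_on_inner continuous_on_id
            bounded_linear.continuous_on[OF matrix_vector_mul_bounded_linear])
      ultimately have "\<exists>x\<in>?S. \<forall>y\<in>?S. x \<bullet> (K *v x) \<le> y \<bullet> (K *v y)"
        by (rule continuous_attains_inf)
      then show ?thesis by (auto simp: P_def)
    qed (auto simp: P_def)
  qed
  then obtain e where e: "P e i (e i)" for i by blast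
  define \<nu> where "\<nu> i = e i \<bullet> (K *v e i)" for i
  have eW: "e i \<in> W e i" and unit: "ip (e i) (e i) = 1"
    and min: "\<And>y. y \<in> W e i \<Longrightarrow> ip y y = 1 \<Longrightarrow> \<nu> i \<le> y \<bullet> (K *v y)" if "i \<in> {1..?N}" for i
    using e[of i] that by (auto simp: P_def \<nu>_def)
  have orth: "ip (e j) (e i) = 0" if "i \<in> {1..?N}" "j \<in> {1..<i}" for i j
    using eW[OF that(1)] that(2) by (simp add: W_def)
  have on: "orthonormal_on {1..?N} e"
    unfolding orthonormal_on_def
  proof clarify
    fix i j assume ij: "i \<in> {1..?N}" "j \<in> {1..?N}"
    show "ip (e i) (e j) = (if i = j then 1 else 0)"
      using orth[OF ij(1), of j] orth[OF ij(2), of i] unit[OF ij(1)] ij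
      by (cases i j rule: linorder_cases) (auto simp: ip_commute[of "e i" "e j"])
  qed
  have eig: "K *v e i = \<nu> i *\<^sub>R (M *v e i)" if "i \<in> {1..?N}" for i
    using that
  proof (induction i rule: less_induct)
    case (less i)
    define r where "r = K *v e i - \<nu> i *\<^sub>R (M *v e i)"
    have rW: "y \<bullet> r = 0" if "y \<in> W e i" for y
      unfolding r_def \<nu>_def
      using Rayleigh_minimizer_stationary[OF K W eW unit _ that] min less.prems
      by (simp add: \<nu>_def)
    have re: "e j \<bullet> r = 0" if j: "j \<in> {1..<i}" for j
    proof -
      have jN: "j \<in> {1..?N}" "j < i" using j less.prems by auto
      have "e j \<bullet> (K *v e i) = (K *v e j) \<bullet> e i"
        by (rule symmetric_matrix_dot[OF K])
      also have "\<dots> = \<nu> j * ip (e j) (e i)"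
        using less.IH[OF jN(2,1)] by (simp add: ip_left)
      finally show ?thesis
        using orth[OF less.prems j] by (simp add: r_def inner_diff_right m_inner_def)
    qed
    \<comment> \<open>The splitting of \<open>r\<close> is with respect to \<open>ip\<close>, but
      \<open>r\<close> is orthogonal to both parts in the Euclidean sense, which gives
      \<open>r \<bullet> r = 0\<close>.\<close>
    have "orthonormal_on {1..<i} e"
      using less.prems by (intro orthonormal_on_subset[OF on]) auto
    then obtain y where y: "y \<in> UNIV" "\<And>j. j \<in> {1..<i} \<Longrightarrow> ip (e j) y = 0"
        "r = y + (\<Sum>j\<in>{1..<i}. ip (e j) r *\<^sub>R e j)"
      using ip_Gram_Schmidt[of "{1..<i}" e UNIV r] by (metis finite_atLeastLessThan subspace_UNIV UNIV_I subset_UNIV)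
    have "y \<in> W e i" using y(2) by (simp add: W_def)
    have "r \<bullet> r = (y + (\<Sum>j\<in>{1..<i}. ip (e j) r *\<^sub>R e j)) \<bullet> r"
      using y(3) by simp
    also have "\<dots> = 0"
      by (simp add: inner_add_left inner_sum_left rW[OF \<open>y \<in> W e i\<close>] re)
    finally have "r = 0" by simp
    then show ?case by (simp add: r_def)
  qed
  have "mono_on {1..?N} \<nu>"
  proof (rule mono_onI)
    fix i j assume ij: "i \<in> {1..?N}" "j \<in> {1..?N}" "i \<le> j"
    \<comment> \<open>The spaces \<open>W e i\<close> shrink as \<open>i\<close> grows, so
      \<open>e j\<close> competes in the minimization that defines \<open>\<nu> i\<close>.\<close>
    have "e j \<in> W e i" using eW[OF ij(2)] ij(3) by (auto simp: W_def)
    from min[OF ij(1) this unit[OF ij(2)]] show "\<nu> i \<le> \<nu> j" by (simp add: \<nu>_def)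
  qed
  with on eig show ?thesis by (intro that[of e \<nu>]) (auto simp: eigenbasis_def)
qed

context
  fixes K e \<nu> assumes eb: "eigenbasis K e \<nu>"
begin

lemma eigenbasis_orthonormal: "orthonormal_on {1..CARD('n)} e"
  using eb by (simp add: eigenbasis_def)

lemma eigenbasis_eigen: "i \<in> {1..CARD('n)} \<Longrightarrow> K *v e i = \<nu> i *\<^sub>R (M *v e i)"
  using eb by (simp add: eigenbasis_def)

lemma eigenbasis_mono: "\<lbrakk>i \<in> {1..CARD('n)}; j \<in> {1..CARD('n)}; i \<le> j\<rbrakk> \<Longrightarrow> \<nu> i \<le> \<nu> j"
  using eb by (auto simp: eigenbasis_def mono_on_def)

lemma eigenbasis_expansion: "x = (\<Sum>i\<in>{1..CARD('n)}. ip (e i) x *\<^sub>R e i)"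
  by (rule orthonormal_expansion[OF eigenbasis_orthonormal, of UNIV]) auto

lemma eigenbasis_ip: "ip x y = (\<Sum>i\<in>{1..CARD('n)}. ip (e i) x * ip (e i) y)"
  by (subst eigenbasis_expansion[of y])
     (simp add: ip_sum_right ip_commute[of x] mult.commute)

lemma eigenbasis_mult: "K *v x = (\<Sum>i\<in>{1..CARD('n)}. (\<nu> i * ip (e i) x) *\<^sub>R (M *v e i))"
  by (subst eigenbasis_expansion[of x])
     (simp add: linear_sum[OF matrix_vector_mul_linear] matrix_vector_mult_scaleR eigenbasis_eigen mult.commute)

lemma eigenbasis_form: "x \<bullet> (K *v y) = (\<Sum>i\<in>{1..CARD('n)}. \<nu> i * ip (e i) x * ip (e i) y)"
  by (subst eigenbasis_mult)
     (simp add: inner_sum_right flip: m_inner_def, simp add: ip_commute[of x] mult_ac)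

lemma eigenbasis_ip_mult:
  assumes "i \<in> {1..CARD('n)}"
  shows "e i \<bullet> (K *v x) = \<nu> i * ip (e i) x"
proof -
  have "e i \<bullet> (K *v x) = (\<Sum>j\<in>{1..CARD('n)}. if i = j then \<nu> j * ip (e j) x else 0)"
    unfolding eigenbasis_form
    by (intro sum.cong) (use assms orthonormal_onD[OF eigenbasis_orthonormal] in auto)
  then show ?thesis using assms by simp
qed

text \<open>Only components with eigenvalue at least \<open>\<nu> j\<close> survive, so both sides
  compare term by term.\<close>

lemma eigenbasis_form_ge:
  assumes "j \<in> {1..CARD('n)}" "\<And>i. i \<in> {1..<j} \<Longrightarrow> ip (e i) x = 0"
  shows "\<nu> j * ip x x \<le> x \<bullet> (K *v x)"
  unfolding eigenbasis_form
proof (subst eigenbasis_ip, subst sum_distrib_left, rule sum_mono)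
  fix i assume i: "i \<in> {1..CARD('n)}"
  show "\<nu> j * (ip (e i) x * ip (e i) x) \<le> \<nu> i * ip (e i) x * ip (e i) x"
  proof (cases "i < j")
    case False
    then have "\<nu> j * (ip (e i) x * ip (e i) x) \<le> \<nu> i * (ip (e i) x * ip (e i) x)"
      using i assms(1) by (intro mult_right_mono eigenbasis_mono) auto
    then show ?thesis by (simp add: mult.assoc)
  qed (use assms i in auto)
qed

lemma eigenbasis_form_le:
  assumes "j \<in> {1..CARD('n)}" "\<And>i. i \<in> {j<..CARD('n)} \<Longrightarrow> ip (e i) x = 0"
  shows "x \<bullet> (K *v x) \<le> \<nu> j * ip x x"
  unfolding eigenbasis_form
proof (subst eigenbasis_ip, subst sum_distrib_left, rule sum_mono)
  fix i assume i: "i \<in> {1..CARD('n)}"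
  show "\<nu> i * ip (e i) x * ip (e i) x \<le> \<nu> j * (ip (e i) x * ip (e i) x)"
  proof (cases "i > j")
    case False
    then have "\<nu> i * (ip (e i) x * ip (e i) x) \<le> \<nu> j * (ip (e i) x * ip (e i) x)"
      using i assms(1) by (intro mult_right_mono eigenbasis_mono) auto
    then show ?thesis by (simp add: mult.assoc)
  qed (use assms i in auto)
qed

end

text \<open>The \<open>CARD('n) - j\<close> vectors of \<open>e\<close> above \<open>j\<close> and
  the \<open>j - 1\<close> vectors of \<open>f\<close> below \<open>j\<close> give one constraint
  fewer than the dimension. A unit vector meeting all of them sees only eigenvalues of
  \<open>K\<close> up to \<open>\<nu> j\<close> and of \<open>L\<close> from \<open>\<mu> j\<close>
  on.\<close>

lemma eigenbasis_compare:
  assumes e: "eigenbasis K e \<nu>" and f: "eigenbasis L f \<mu>" and j: "j \<in> {1..CARD('n)}"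
  obtains x where "ip x x = 1" "x \<bullet> (K *v x) \<le> \<nu> j" "\<mu> j \<le> x \<bullet> (L *v x)"
proof -
  let ?I = "(Inl ` {j<..CARD('n)} \<union> Inr ` {1..<j}) :: (nat + nat) set"
  have "card ?I = (CARD('n) - j) + (j - 1)"
    by (subst card_Un_disjoint) (auto simp: card_image)
  then have "card ?I < dim (UNIV :: (real^'n) set)"
    using j by auto
  then obtain x where x: "ip x x = 1" "\<And>i. i \<in> ?I \<Longrightarrow> ip (case_sum e f i) x = 0"
    using unit_orthogonal_in_subspace[of UNIV ?I "case_sum e f"]
    by (metis finite_UnI finite_imageI finite_greaterThanAtMost finite_atLeastLessThan subspace_UNIV)
  have "ip (e i) x = 0" if "i \<in> {j<..CARD('n)}" for i
    using x(2)[of "Inl i"] that by auto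
  moreover have "ip (f i) x = 0" if "i \<in> {1..<j}" for i
    using x(2)[of "Inr i"] that by auto
  ultimately show ?thesis
    using that[OF x(1)] eigenbasis_form_le[OF e j, of x] eigenbasis_form_ge[OF f j, of x] x(1)
    by auto
qed

section \<open>Eigenvalues, eigenspaces and outliers read off an eigenbasis\<close>

context
  fixes K e \<nu> assumes eb: "eigenbasis K e \<nu>"
begin

lemma ip_span_eigenbasis:
  assumes "J \<subseteq> {1..CARD('n)}" "x \<in> span (e ` J)" "i \<in> {1..CARD('n)}" "i \<notin> J"
  shows "ip (e i) x = 0"
  using assms(2)
proof (induction rule: span_induct)
  case base
  show ?case by (simp add: subspace_def)
next
  case (step y)
  then show ?case
    using assms orthonormal_onD[OF eigenbasis_orthonormal[OF eb]] by fastforce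
qed

lemma span_eigenbasis_if:
  assumes "J \<subseteq> {1..CARD('n)}" "\<And>i. i \<in> {1..CARD('n)} - J \<Longrightarrow> ip (e i) x = 0"
  shows "x \<in> span (e ` J)"
proof -
  have "x = (\<Sum>i\<in>{1..CARD('n)}. ip (e i) x *\<^sub>R e i)"
    by (rule eigenbasis_expansion[OF eb])
  also have "\<dots> = (\<Sum>i\<in>J. ip (e i) x *\<^sub>R e i)"
    using assms by (intro sum.mono_neutral_right) auto
  also have "\<dots> \<in> span (e ` J)"
    by (intro span_sum span_scale span_base) auto
  finally show ?thesis .
qed

lemma dim_span_eigenbasis:
  assumes "J \<subseteq> {1..CARD('n)}"
  shows "dim (span (e ` J)) = card J"
proof -
  have on: "orthonormal_on J e"
    using eigenbasis_orthonormal[OF eb] assms by (rule orthonormal_on_subset)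
  show ?thesis
    using dim_eq_card_independent[OF orthonormal_independent[OF on]]
      card_image[OF orthonormal_inj_on[OF on]] by simp
qed

lemma subspace_gen_eigenspace: "subspace (gen_eigenspace K M \<mu>)"
  unfolding gen_eigenspace_def subspace_def
  by (simp add: matrix_vector_right_distrib matrix_vector_mult_scaleR scaleR_right_distrib)

text \<open>For \<open>x\<close> in the eigenspace, evaluating \<open>e i \<bullet> (K *v x)\<close>
  in two ways gives \<open>\<nu> i * ip (e i) x = \<mu> * ip (e i) x\<close>, so only coefficients
  with \<open>\<nu> i = \<mu>\<close> survive.\<close>

lemma gen_eigenspace_eq: "gen_eigenspace K M \<mu> = span (e ` {i \<in> {1..CARD('n)}. \<nu> i = \<mu>})"
proof
  show "gen_eigenspace K M \<mu> \<subseteq> span (e ` {i \<in> {1..CARD('n)}. \<nu> i = \<mu>})"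
  proof
    fix x assume "x \<in> gen_eigenspace K M \<mu>"
    then have x: "K *v x = \<mu> *\<^sub>R (M *v x)" by (simp add: gen_eigenspace_def)
    show "x \<in> span (e ` {i \<in> {1..CARD('n)}. \<nu> i = \<mu>})"
    proof (rule span_eigenbasis_if)
      fix i assume i: "i \<in> {1..CARD('n)} - {i \<in> {1..CARD('n)}. \<nu> i = \<mu>}"
      have "\<nu> i * ip (e i) x = e i \<bullet> (K *v x)"
        using eigenbasis_ip_mult[OF eb, of i x] i by simp
      also have "\<dots> = \<mu> * ip (e i) x"
        by (simp add: x m_inner_def)
      finally show "ip (e i) x = 0" using i by auto
    qed auto
  qed
  show "span (e ` {i \<in> {1..CARD('n)}. \<nu> i = \<mu>}) \<subseteq> gen_eigenspace K M \<mu>"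
    using eigenbasis_eigen[OF eb]
    by (intro span_minimal subspace_gen_eigenspace) (auto simp: gen_eigenspace_def)
qed

lemma is_gen_eigenvalue_iff: "is_gen_eigenvalue K M \<mu> \<longleftrightarrow> \<mu> \<in> \<nu> ` {1..CARD('n)}"
proof -
  have "is_gen_eigenvalue K M \<mu> \<longleftrightarrow> dim (gen_eigenspace K M \<mu>) \<noteq> 0"
    by (auto simp: is_gen_eigenvalue_def gen_eigenspace_def dim_eq_0)
  also have "\<dots> \<longleftrightarrow> {i \<in> {1..CARD('n)}. \<nu> i = \<mu>} \<noteq> {}"
    by (subst gen_eigenspace_eq, subst dim_span_eigenbasis) auto
  finally show ?thesis by auto
qed

text \<open>The dimension of an eigenspace counts the indices that carry its eigenvalue.\<close>

lemma gen_eigenvalues_eq: "gen_eigenvalues K M = image_mset \<nu> (mset_set {1..CARD('n)})"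
proof (rule multiset_eqI)
  fix a
  have "{\<mu>. is_gen_eigenvalue K M \<mu>} = \<nu> ` {1..CARD('n)}"
    by (auto simp: is_gen_eigenvalue_iff)
  then have "count (gen_eigenvalues K M) a
      = (\<Sum>\<mu>\<in>\<nu> ` {1..CARD('n)}. if \<mu> = a then dim (gen_eigenspace K M \<mu>) else 0)"
    unfolding gen_eigenvalues_def by (auto simp: count_sum intro!: sum.cong)
  also have "\<dots> = (if a \<in> \<nu> ` {1..CARD('n)} then dim (gen_eigenspace K M a) else 0)"
    by simp
  also have "\<dots> = card {i \<in> {1..CARD('n)}. \<nu> i = a}"
    by (subst gen_eigenspace_eq, subst dim_span_eigenbasis) (auto simp: card_eq_0_iff)
  also have "\<dots> = count (image_mset \<nu> (mset_set {1..CARD('n)})) a"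
  proof -
    have "count (image_mset \<nu> (mset_set {1..CARD('n)})) a = (\<Sum>i | i \<in> {1..CARD('n)} \<and> \<nu> i = a. 1)"
      unfolding count_image_mset' by (intro sum.cong) auto
    then show ?thesis by simp
  qed
  finally show "count (gen_eigenvalues K M) a = count (image_mset \<nu> (mset_set {1..CARD('n)})) a" .
qed

text \<open>A nondecreasing list is its own sorted version; it starts with \<open>\<nu> 1\<close>,
  which matches the shift \<open>j - 1\<close> in \<open>gen_eigenvalue\<close>.\<close>

lemma gen_eigenvalue_eq:
  assumes "j \<in> {1..CARD('n)}"
  shows "gen_eigenvalue K M j = \<nu> j"
proof -
  have "gen_eigenvalues K M = mset (map \<nu> [1..<Suc CARD('n)])"
    by (simp add: gen_eigenvalues_eq atLeastLessThanSuc_atLeastAtMost del: upt_Suc)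
  moreover have "sorted (map \<nu> [1..<Suc CARD('n)])"
    unfolding sorted_map
    by (rule sorted_wrt_mono_rel[of _ "(\<le>)"]) (auto intro: eigenbasis_mono[OF eb] simp del: upt_Suc)
  ultimately have "sorted_list_of_multiset (gen_eigenvalues K M) = map \<nu> [1..<Suc CARD('n)]"
    by (metis sorted_list_of_multiset_mset sorted_sort_id)
  then show ?thesis
    using assms unfolding gen_eigenvalue_def by (auto simp: nth_map simp del: upt_Suc)
qed

lemma outlier_eigenspace_eq:
  assumes k: "1 \<le> k" "k < CARD('n)" and gap: "\<nu> (CARD('n) - k) < \<nu> (CARD('n) - k + 1)"
  shows "outlier_eigenspace K M k = span (e ` {CARD('n) - k + 1..CARD('n)})"
proof -
  let ?J = "{CARD('n) - k + 1..CARD('n)}"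
  have J: "?J \<subseteq> {1..CARD('n)}" by auto
  have "(\<Union>j\<in>?J. gen_eigenspace K M (gen_eigenvalue K M j)) \<subseteq> span (e ` ?J)"
  proof (rule UN_least)
    fix j assume j: "j \<in> ?J"
    \<comment> \<open>A tie across the cut would bring further eigenvectors into the span; the
      strict gap rules it out.\<close>
    have "{i \<in> {1..CARD('n)}. \<nu> i = \<nu> j} \<subseteq> ?J"
    proof
      fix i assume i: "i \<in> {i \<in> {1..CARD('n)}. \<nu> i = \<nu> j}"
      show "i \<in> ?J"
      proof (rule ccontr)
        assume "i \<notin> ?J"
        then have "\<nu> i \<le> \<nu> (CARD('n) - k)"
          using i k by (intro eigenbasis_mono[OF eb]) auto
        also note gap
        also have "\<nu> (CARD('n) - k + 1) \<le> \<nu> j"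
          using j k by (intro eigenbasis_mono[OF eb]) auto
        finally show False using i by simp
      qed
    qed
    then have "gen_eigenspace K M (\<nu> j) \<subseteq> span (e ` ?J)"
      unfolding gen_eigenspace_eq by (intro span_mono image_mono)
    then show "gen_eigenspace K M (gen_eigenvalue K M j) \<subseteq> span (e ` ?J)"
      using gen_eigenvalue_eq[of j] j J by (metis subsetD)
  qed
  moreover have "e ` ?J \<subseteq> (\<Union>j\<in>?J. gen_eigenspace K M (gen_eigenvalue K M j))"
  proof (rule image_subsetI, rule UN_I)
    fix j assume j: "j \<in> ?J"
    then show "j \<in> ?J" .
    from j J have "j \<in> {1..CARD('n)}" by blast
    then show "e j \<in> gen_eigenspace K M (gen_eigenvalue K M j)"
      using eigenbasis_eigen[OF eb, of j] gen_eigenvalue_eq[of j] by (simp add: gen_eigenspace_def)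
  qed
  ultimately show ?thesis
    unfolding outlier_eigenspace_def by (intro subset_antisym span_minimal span_mono subspace_span)
qed

end
end

section \<open>The inverse square root of \<open>M\<close> and the spectral norm\<close>

lemma spd_matrix_mat_1: "spd_matrix (mat 1)"
  by (simp add: spd_matrix_def symmetric_matrix_def)

lemma m_inner_mat_1: "m_inner (mat 1) x y = x \<bullet> y"
  by (simp add: m_inner_def)

text \<open>On an eigenvector of \<open>S - T\<close>, the identity
  \<open>S ** S - T ** T = S ** (S - T) + (S - T) ** T\<close> shows that \<open>\<nu> i\<close>
  times a positive number is zero. So all eigenvalues of \<open>S - T\<close> vanish.\<close>

lemma spd_square_root_unique:
  assumes S: "spd_matrix S" and T: "spd_matrix T" and eq: "S ** S = T ** T"
  shows "S = T"
proof -
  interpret I: spd_form "mat 1" by standard (rule spd_matrix_mat_1)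
  have sym: "symmetric_matrix S" "symmetric_matrix T"
    using S T by (auto simp: spd_matrix_def)
  then have D: "symmetric_matrix (S - T)"
    by (simp add: symmetric_matrix_def transpose_def vec_eq_iff)
  obtain e \<nu> where eb: "I.eigenbasis (S - T) e \<nu>"
    using I.eigenbasis_exists[OF D] by blast
  have "\<nu> i = 0" if i: "i \<in> {1..CARD('a)}" for i
  proof -
    have ev: "(S - T) *v e i = \<nu> i *\<^sub>R e i"
      using I.eigenbasis_eigen[OF eb i] by simp
    have "e i \<noteq> 0"
      using I.orthonormal_onD[OF I.eigenbasis_orthonormal[OF eb] i i] by auto
    then have pos: "0 < e i \<bullet> (S *v e i) + e i \<bullet> (T *v e i)"
      using S T by (auto simp: spd_matrix_def intro!: add_pos_pos)
    have "0 = e i \<bullet> ((S ** S - T ** T) *v e i)"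
      using eq by simp
    also have "\<dots> = e i \<bullet> (S *v ((S - T) *v e i)) + e i \<bullet> ((S - T) *v (T *v e i))"
      by (simp add: matrix_vector_mult_diff_rdistrib matrix_vector_mult_diff_distrib
          inner_diff_right flip: matrix_vector_mul_assoc)
    also have "e i \<bullet> ((S - T) *v (T *v e i)) = ((S - T) *v e i) \<bullet> (T *v e i)"
      by (rule symmetric_matrix_dot[OF D])
    also have "e i \<bullet> (S *v ((S - T) *v e i)) + ((S - T) *v e i) \<bullet> (T *v e i)
        = \<nu> i * (e i \<bullet> (S *v e i) + e i \<bullet> (T *v e i))"
      by (simp add: ev matrix_vector_mult_scaleR distrib_left)
    finally show ?thesis using pos by auto
  qed
  then have "(S - T) *v x = 0" for x
    by (subst I.eigenbasis_mult[OF eb]) simp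
  then show ?thesis
    by (simp add: matrix_eq matrix_vector_mult_diff_rdistrib)
qed

text \<open>\<open>S\<close> multiplies each eigenvector \<open>g i\<close> of \<open>M\<close> by
  \<open>1 / sqrt (d i)\<close>, where \<open>d i\<close> is its positive eigenvalue.\<close>

lemma spd_inverse_square_root_exists:
  assumes M: "spd_matrix M"
  obtains S where "spd_matrix S" "M ** (S ** S) = mat 1"
proof -
  interpret I: spd_form "mat 1" by standard (rule spd_matrix_mat_1)
  obtain g d where eb: "I.eigenbasis M g d"
    using I.eigenbasis_exists M unfolding spd_matrix_def by metis
  have on: "g i \<bullet> g j = (if i = j then 1 else 0)" if "i \<in> {1..CARD('a)}" "j \<in> {1..CARD('a)}" for i j
    using I.orthonormal_onD[OF I.eigenbasis_orthonormal[OF eb] that] by (simp add: m_inner_mat_1)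
  have d: "d i > 0" if "i \<in> {1..CARD('a)}" for i
  proof -
    have "g i \<noteq> 0" using on[OF that that] by auto
    then have "0 < g i \<bullet> (M *v g i)" using M by (simp add: spd_matrix_def)
    also have "\<dots> = d i" using I.eigenbasis_eigen[OF eb that] on[OF that that] by simp
    finally show ?thesis .
  qed
  define f where "f x = (\<Sum>i\<in>{1..CARD('a)}. ((g i \<bullet> x) / sqrt (d i)) *\<^sub>R g i)" for x
  have "linear f"
    unfolding f_def
    by (intro linear_compose_sum ballI)
       (auto intro!: linearI simp: inner_right_distrib add_divide_distrib scaleR_left_distrib)
  define S where "S = matrix f"
  have S: "S *v x = f x" for x
    unfolding S_def using \<open>linear f\<close> by (simp add: matrix_works linear_matrix_vector_mul_eq)
  have gf: "g i \<bullet> f x = (g i \<bullet> x) / sqrt (d i)" if "i \<in> {1..CARD('a)}" for i x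
  proof -
    have "g i \<bullet> f x = (\<Sum>j\<in>{1..CARD('a)}. if i = j then (g j \<bullet> x) / sqrt (d j) else 0)"
      unfolding f_def inner_sum_right by (intro sum.cong) (use on that in auto)
    then show ?thesis using that by simp
  qed
  have yf: "y \<bullet> f x = (\<Sum>i\<in>{1..CARD('a)}. (g i \<bullet> x) * (g i \<bullet> y) / sqrt (d i))" for x y
    by (simp add: f_def inner_sum_right inner_commute)
  have "symmetric_matrix S"
  proof -
    have "x \<bullet> (transpose S *v y) = x \<bullet> (S *v y)" for x y
    proof -
      have "x \<bullet> (transpose S *v y) = y \<bullet> (S *v x)"
        by (metis dot_lmul_matrix inner_commute transpose_matrix_vector)
      then show ?thesis by (simp add: S yf mult.commute)
    qed
    then have "transpose S *v y = S *v y" for y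
      using vector_eq_ldot by blast
    then show ?thesis by (simp add: symmetric_matrix_def matrix_eq)
  qed
  moreover have "0 < x \<bullet> (S *v x)" if "x \<noteq> 0" for x
  proof -
    have "\<exists>i\<in>{1..CARD('a)}. g i \<bullet> x \<noteq> 0"
      using I.eigenbasis_expansion[OF eb, of x] that
      by (metis (no_types, lifting) m_inner_mat_1 scaleR_zero_left sum.neutral)
    then obtain i where i: "i \<in> {1..CARD('a)}" "g i \<bullet> x \<noteq> 0" by blast
    show ?thesis
      unfolding S yf
    proof (rule sum_pos2[OF _ i(1)])
      show "0 < (g i \<bullet> x) * (g i \<bullet> x) / sqrt (d i)"
        using i(2) d[OF i(1)] by (intro divide_pos_pos) (auto simp: zero_less_mult_iff)
      show "0 \<le> (g j \<bullet> x) * (g j \<bullet> x) / sqrt (d j)" if "j \<in> {1..CARD('a)}" for j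
        using d[OF that] by simp
    qed simp
  qed
  ultimately have "spd_matrix S" by (simp add: spd_matrix_def)
  moreover have "M ** (S ** S) = mat 1"
    unfolding matrix_eq
  proof
    fix x
    have "(M ** (S ** S)) *v x = M *v (S *v (S *v x))"
      by (simp add: matrix_vector_mul_assoc matrix_mul_assoc)
    also have "\<dots> = (\<Sum>i\<in>{1..CARD('a)}. (d i * (g i \<bullet> f (f x))) *\<^sub>R g i)"
      using I.eigenbasis_mult[OF eb] by (simp add: S m_inner_mat_1)
    also have "\<dots> = (\<Sum>i\<in>{1..CARD('a)}. (g i \<bullet> x) *\<^sub>R g i)"
    proof (rule sum.cong)
      fix i assume i: "i \<in> {1..CARD('a)}"
      have "d i * (g i \<bullet> f (f x)) = g i \<bullet> x"
        using d[OF i] by (simp add: gf[OF i] field_simps)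
      then show "(d i * (g i \<bullet> f (f x))) *\<^sub>R g i = (g i \<bullet> x) *\<^sub>R g i" by simp
    qed simp
    also have "\<dots> = x"
      using I.eigenbasis_expansion[OF eb, of x] by (simp add: m_inner_mat_1)
    finally show "(M ** (S ** S)) *v x = mat 1 *v x" by simp
  qed
  ultimately show ?thesis by (rule that)
qed

context spd_form begin

lemma inv_sqrt_matrix:
  shows spd_inv_sqrt_matrix: "spd_matrix (inv_sqrt_matrix M)"
    and inv_sqrt_matrix_mult: "inv_sqrt_matrix M ** inv_sqrt_matrix M ** M = mat 1"
proof -
  obtain S where S: "spd_matrix S" "M ** (S ** S) = mat 1"
    using spd_inverse_square_root_exists[OF spd] by blast
  have SM: "S ** S ** M = mat 1"
    using S(2) matrix_left_right_inverse by blast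
  have inv: "S ** S = matrix_inv M"
  proof -
    \<comment> \<open>\<open>matrix_inv\<close> is a choice, so its properties follow once a
      two-sided inverse, here \<open>S ** S\<close>, is exhibited.\<close>
    have "M ** matrix_inv M = mat 1"
      using S(2) SM someI[of "\<lambda>A. M ** A = mat 1 \<and> A ** M = mat 1" "S ** S"]
      by (simp add: matrix_inv_def)
    then show ?thesis
      by (metis SM matrix_mul_assoc matrix_mul_lid matrix_mul_rid)
  qed
  have "inv_sqrt_matrix M = S"
    unfolding inv_sqrt_matrix_def
    using S(1) inv by (intro the_equality) (auto intro: spd_square_root_unique)
  with S SM show "spd_matrix (inv_sqrt_matrix M)"
      "inv_sqrt_matrix M ** inv_sqrt_matrix M ** M = mat 1"
    by simp_all
qed

text \<open>Writing \<open>x = S *v p x\<close> turns \<open>M\<close>-norms into Euclidean norms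
  and the form of \<open>D\<close> into that of \<open>S ** D ** S\<close>, where Cauchy-Schwarz and
  the operator norm apply.\<close>

lemma form_le_spectral_norm:
  "\<bar>w \<bullet> (D *v u)\<bar>
    \<le> spectral_norm (inv_sqrt_matrix M ** D ** inv_sqrt_matrix M) * sqrt (ip w w) * sqrt (ip u u)"
proof -
  define S where "S = inv_sqrt_matrix M"
  have sym: "symmetric_matrix S"
    using spd_inv_sqrt_matrix by (simp add: S_def spd_matrix_def)
  \<comment> \<open>\<open>p\<close> applies the positive square root of \<open>M\<close>:
    \<open>S ** S\<close> inverts \<open>M\<close>, so that root is \<open>S ** M\<close>.\<close>
  define p where "p x = S *v (M *v x)" for x
  have Sp: "S *v p x = x" for x
    using inv_sqrt_matrix_mult by (simp add: p_def S_def matrix_vector_mul_assoc matrix_mul_assoc)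
  have norm_p: "norm (p x) = sqrt (ip x x)" for x
  proof -
    have "p x \<bullet> p x = (S *v p x) \<bullet> (M *v x)"
      by (simp add: p_def symmetric_matrix_dot[OF sym, symmetric])
    then show ?thesis by (simp add: Sp norm_eq_sqrt_inner m_inner_def)
  qed
  have "w \<bullet> (D *v u) = (S *v p w) \<bullet> (D *v (S *v p u))" by (simp add: Sp)
  also have "\<dots> = p w \<bullet> (S *v (D *v (S *v p u)))"
    by (rule symmetric_matrix_dot[OF sym, symmetric])
  also have "\<dots> = p w \<bullet> ((S ** D ** S) *v p u)"
    by (simp add: matrix_vector_mul_assoc matrix_mul_assoc)
  finally have "\<bar>w \<bullet> (D *v u)\<bar> \<le> norm (p w) * norm ((S ** D ** S) *v p u)"
    by (simp add: Cauchy_Schwarz_ineq2)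
  also have "\<dots> \<le> norm (p w) * (spectral_norm (S ** D ** S) * norm (p u))"
    unfolding spectral_norm_def
    by (intro mult_left_mono onorm matrix_vector_mul_bounded_linear) auto
  finally show ?thesis by (simp add: norm_p S_def mult_ac)
qed

section \<open>Principal vectors and singular pairs\<close>

lemma principal_candidate_swap:
  "principal_candidate M V U v u i y x \<longleftrightarrow> principal_candidate M U V u v i x y"
  unfolding principal_candidate_def by auto

lemma principal_vectors_swap:
  assumes "principal_vectors M U V u v"
  shows "principal_vectors M V U v u"
  unfolding principal_vectors_def principal_candidate_swap[of V U]
proof (intro ballI conjI allI impI)
  fix i assume "i \<in> {1..min (dim V) (dim U)}"
  then have i: "i \<in> {1..min (dim U) (dim V)}" by (simp add: min.commute)
  with assms show "principal_candidate M U V u v i (u i) (v i)"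
    unfolding principal_vectors_def by blast
  fix x y assume "principal_candidate M U V u v i y x"
  with assms i have "ip y x \<le> ip (u i) (v i)"
    unfolding principal_vectors_def by blast
  then show "ip x y \<le> ip (v i) (u i)"
    by (simp only: ip_commute[of x y] ip_commute[of "v i" "u i"])
qed

text \<open>Each maximization runs over a compact set of pairs, nonempty because
  \<open>i - 1\<close> constraints cannot exhaust a subspace of dimension at least
  \<open>i\<close>.\<close>

lemma principal_vectors_exist:
  assumes U: "subspace U" and V: "subspace V"
  obtains u v where "principal_vectors M U V u v"
proof -
  let ?d = "min (dim U) (dim V)"
  define A where "A p i = {x \<in> U. \<forall>j\<in>{1..<i}. ip (fst (p j)) x = 0}"
    for p :: "nat \<Rightarrow> (real^'n) \<times> (real^'n)" and i :: nat
  define B where "B p i = {y \<in> V. \<forall>j\<in>{1..<i}. ip (snd (p j)) y = 0}"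
    for p :: "nat \<Rightarrow> (real^'n) \<times> (real^'n)" and i :: nat
  define C where "C p i = ({x. ip x x = 1} \<inter> A p i) \<times> ({y. ip y y = 1} \<inter> B p i)" for p i
  have C: "principal_candidate M U V (\<lambda>i. fst (p i)) (\<lambda>i. snd (p i)) i x y \<longleftrightarrow> (x, y) \<in> C p i" for p i x y
    by (auto simp: principal_candidate_def C_def A_def B_def)
  have "\<exists>p. \<forall>i. i \<in> {1..?d} \<longrightarrow> p i \<in> C p i \<and> (\<forall>r\<in>C p i. ip (fst r) (snd r) \<le> ip (fst (p i)) (snd (p i)))"
  proof (rule dependent_wellorder_choice)
    fix r i and p q :: "nat \<Rightarrow> (real^'n) \<times> (real^'n)"
    assume "\<And>j. j < i \<Longrightarrow> p j = q j"
    then have "C p i = C q i" by (simp add: C_def A_def B_def)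
    then show "(i \<in> {1..?d} \<longrightarrow> r \<in> C p i \<and> (\<forall>s\<in>C p i. ip (fst s) (snd s) \<le> ip (fst r) (snd r)))
        = (i \<in> {1..?d} \<longrightarrow> r \<in> C q i \<and> (\<forall>s\<in>C q i. ip (fst s) (snd s) \<le> ip (fst r) (snd r)))"
      by simp
  next
    fix i and p :: "nat \<Rightarrow> (real^'n) \<times> (real^'n)"
    show "\<exists>r. i \<in> {1..?d} \<longrightarrow> r \<in> C p i \<and> (\<forall>s\<in>C p i. ip (fst s) (snd s) \<le> ip (fst r) (snd r))"
    proof (cases "i \<in> {1..?d}")
      case True
      have "subspace (A p i)" "subspace (B p i)"
        unfolding A_def B_def by (rule subspace_ip_orthogonal[OF U] subspace_ip_orthogonal[OF V])+
      then have "compact (C p i)"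
        unfolding C_def by (intro compact_Times compact_Int_closed compact_ip_sphere closed_subspace)
      moreover have "C p i \<noteq> {}"
      proof -
        obtain x where "x \<in> U" "ip x x = 1" "\<And>j. j \<in> {1..<i} \<Longrightarrow> ip (fst (p j)) x = 0"
          by (rule unit_orthogonal_in_subspace[of U "{1..<i}" "\<lambda>j. fst (p j)"]) (use True U in auto)
        moreover obtain y where "y \<in> V" "ip y y = 1" "\<And>j. j \<in> {1..<i} \<Longrightarrow> ip (snd (p j)) y = 0"
          by (rule unit_orthogonal_in_subspace[of V "{1..<i}" "\<lambda>j. snd (p j)"]) (use True V in auto)
        ultimately show ?thesis by (auto simp: C_def A_def B_def)
      qed
      moreover have "continuous_on (C p i) (\<lambda>r. ip (fst r) (snd r))"
        by (intro continuous_on_ip continuous_on_fst continuous_on_snd continuous_on_id)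
      ultimately have "\<exists>r\<in>C p i. \<forall>s\<in>C p i. ip (fst s) (snd s) \<le> ip (fst r) (snd r)"
        by (rule continuous_attains_sup)
      then show ?thesis by blast
    qed blast
  qed
  then obtain p where p: "\<And>i. i \<in> {1..?d} \<Longrightarrow>
      p i \<in> C p i \<and> (\<forall>r\<in>C p i. ip (fst r) (snd r) \<le> ip (fst (p i)) (snd (p i)))"
    by blast
  have "principal_vectors M U V (\<lambda>i. fst (p i)) (\<lambda>i. snd (p i))"
    unfolding principal_vectors_def C
  proof (intro ballI conjI allI impI)
    fix i assume i: "i \<in> {1..?d}"
    show "(fst (p i), snd (p i)) \<in> C p i"
      using p[OF i] by simp
    show "ip x y \<le> ip (fst (p i)) (snd (p i))" if "(x, y) \<in> C p i" for x y
      using p[OF i] that by fastforce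
  qed
  then show ?thesis by (rule that)
qed

text \<open>With \<open>v i\<close> held fixed, \<open>u i\<close> maximizes
  \<open>ip x (v i)\<close> over the unit vectors of \<open>U\<close> orthogonal to the earlier
  \<open>u j\<close>.\<close>

lemma principal_vectors_stationary:
  assumes U: "subspace U" and pv: "principal_vectors M U V u v" and i: "i \<in> {1..min (dim U) (dim V)}"
    and x: "x \<in> U" "\<And>j. j \<in> {1..<i} \<Longrightarrow> ip (u j) x = 0"
  shows "ip x (v i) = ip (u i) (v i) * ip x (u i)"
proof (rule ip_unit_maximizer)
  have c: "principal_candidate M U V u v i (u i) (v i)"
    and max: "\<And>x y. principal_candidate M U V u v i x y \<Longrightarrow> ip x y \<le> ip (u i) (v i)"
    using pv i by (auto simp: principal_vectors_def)
  let ?W = "{x \<in> U. \<forall>j\<in>{1..<i}. ip (u j) x = 0}"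
  show "subspace ?W" by (rule subspace_ip_orthogonal[OF U])
  show "u i \<in> ?W" "ip (u i) (u i) = 1" using c by (auto simp: principal_candidate_def)
  show "x \<in> ?W" using x by blast
  show "ip y (v i) \<le> ip (u i) (v i)" if "y \<in> ?W" "ip y y = 1" for y
    using c that by (intro max) (auto simp: principal_candidate_def)
qed

lemma principal_vectors_orthonormal:
  assumes "principal_vectors M U V u v"
  shows "orthonormal_on {1..min (dim U) (dim V)} u"
  unfolding orthonormal_on_def
proof clarify
  fix i j assume ij: "i \<in> {1..min (dim U) (dim V)}" "j \<in> {1..min (dim U) (dim V)}"
  have "ip (u i) (u i) = 1 \<and> (\<forall>j\<in>{1..<i}. ip (u j) (u i) = 0)"
    if "i \<in> {1..min (dim U) (dim V)}" for i
    using assms that by (auto simp: principal_vectors_def principal_candidate_def)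
  from this[OF ij(1)] this[OF ij(2)]
  have "i < j \<Longrightarrow> ip (u i) (u j) = 0" "j < i \<Longrightarrow> ip (u j) (u i) = 0" "ip (u i) (u i) = 1"
    using ij by auto
  then show "ip (u i) (u j) = (if i = j then 1 else 0)"
    using ip_commute[of "u i" "u j"] by (cases i j rule: linorder_cases) auto
qed

text \<open>A singular triple of \<open>ip\<close> restricted to \<open>U\<close> and
  \<open>V\<close>: \<open>y\<close> projects onto \<open>U\<close> as
  \<open>\<sigma> *\<^sub>R x\<close>, and \<open>x\<close> onto \<open>V\<close> as
  \<open>\<sigma> *\<^sub>R y\<close>. Unlike principal vectors, it makes no reference to earlier
  pairs.\<close>

definition singular_pair ::
    "(real^'n) set \<Rightarrow> (real^'n) set \<Rightarrow> real \<Rightarrow> real^'n \<Rightarrow> real^'n \<Rightarrow> bool" where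
  "singular_pair U V \<sigma> x y \<longleftrightarrow>
     x \<in> U \<and> y \<in> V \<and> ip x x = 1 \<and> ip y y = 1 \<and> 0 \<le> \<sigma> \<and>
     (\<forall>z\<in>U. ip z y = \<sigma> * ip z x) \<and> (\<forall>z\<in>V. ip z x = \<sigma> * ip z y)"

text \<open>Stationarity covers test vectors orthogonal to the earlier \<open>u j\<close>. The
  remaining directions contribute nothing, because each earlier \<open>u j\<close> is orthogonal to
  both \<open>u i\<close> and \<open>v i\<close>.\<close>

lemma principal_vectors_project:
  assumes U: "subspace U" and V: "subspace V"
    and pv: "principal_vectors M U V u v" and i: "i \<in> {1..min (dim U) (dim V)}" and z: "z \<in> U"
  shows "ip z (v i) = ip (u i) (v i) * ip z (u i)"
proof -
  let ?d = "min (dim U) (dim V)"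
  have c: "principal_candidate M U V u v j (u j) (v j)" if "j \<in> {1..?d}" for j
    using pv that by (auto simp: principal_vectors_def)
  have sub: "{1..<i} \<subseteq> {1..?d}" using i by auto
  have uv: "ip (u j) (v i) = 0" "ip (u j) (u i) = 0" if j: "j \<in> {1..<i}" for j
  proof -
    have jd: "j \<in> {1..?d}" using j sub by blast
    have vi: "v i \<in> V" "\<And>l. l \<in> {1..<i} \<Longrightarrow> ip (v l) (v i) = 0"
      using c[OF i] by (auto simp: principal_candidate_def)
    \<comment> \<open>Since \<open>j < i\<close>, the vector \<open>v i\<close> is an admissible
      test vector at stage \<open>j\<close> in \<open>V\<close>, and it is orthogonal to
      \<open>v j\<close>.\<close>
    have "ip (v i) (u j) = ip (v j) (u j) * ip (v i) (v j)"
      by (rule principal_vectors_stationary[OF V principal_vectors_swap[OF pv]])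
         (use jd vi j in \<open>auto simp: min.commute\<close>)
    then show "ip (u j) (v i) = 0"
      using vi(2)[OF j] by (simp add: ip_commute[of "u j" "v i"] ip_commute[of "v i" "v j"])
    show "ip (u j) (u i) = 0"
      using c[OF i] j by (auto simp: principal_candidate_def)
  qed
  have "u ` {1..<i} \<subseteq> U"
    using c sub by (auto simp: principal_candidate_def)
  then obtain y where y: "y \<in> U" "\<And>j. j \<in> {1..<i} \<Longrightarrow> ip (u j) y = 0"
      and zy: "z = y + (\<Sum>j\<in>{1..<i}. ip (u j) z *\<^sub>R u j)"
    using ip_Gram_Schmidt[OF orthonormal_on_subset[OF principal_vectors_orthonormal[OF pv] sub] _ U _ z]
    by blast
  have "ip z (v i) = ip y (v i)"
    by (subst zy) (simp add: ip_commute[of _ "v i"] ip_sum_right uv[unfolded ip_commute[of _ "v i"]])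
  also have "\<dots> = ip (u i) (v i) * ip y (u i)"
    by (rule principal_vectors_stationary[OF U pv i y])
  also have "ip y (u i) = ip z (u i)"
    by (subst zy) (simp add: ip_commute[of _ "u i"] ip_sum_right uv[unfolded ip_commute[of _ "u i"]])
  finally show ?thesis .
qed

lemma principal_vectors_singular_pair:
  assumes U: "subspace U" and V: "subspace V"
    and pv: "principal_vectors M U V u v" and i: "i \<in> {1..min (dim U) (dim V)}"
  shows "singular_pair U V (ip (u i) (v i)) (u i) (v i)"
proof -
  have c: "principal_candidate M U V u v i (u i) (v i)"
    and max: "\<And>x y. principal_candidate M U V u v i x y \<Longrightarrow> ip x y \<le> ip (u i) (v i)"
    using pv i by (auto simp: principal_vectors_def)
  \<comment> \<open>Flipping the sign of \<open>u i\<close> keeps the pair admissible, so the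
    maximum cannot be negative.\<close>
  have "principal_candidate M U V u v i (- u i) (v i)"
    using c U by (auto simp: principal_candidate_def subspace_neg)
  from max[OF this] have "0 \<le> ip (u i) (v i)" by simp
  moreover have "ip z (u i) = ip (u i) (v i) * ip z (v i)" if "z \<in> V" for z
    using principal_vectors_project[OF V U principal_vectors_swap[OF pv] _ that, of i] i
    by (simp add: min.commute ip_commute[of "u i" "v i"])
  moreover have "ip z (v i) = ip (u i) (v i) * ip z (u i)" if "z \<in> U" for z
    by (rule principal_vectors_project[OF U V pv i that])
  moreover have "u i \<in> U" "v i \<in> V" "ip (u i) (u i) = 1" "ip (v i) (v i) = 1"
    using c by (simp_all add: principal_candidate_def)
  ultimately show ?thesis
    unfolding singular_pair_def by blast
qed

text \<open>Left singular vectors of distinct singular values are \<open>M\<close>-orthogonal.\<close>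

lemma finite_singular_values: "finite {\<sigma>. \<exists>x y. singular_pair U V \<sigma> x y}"
proof -
  let ?S = "{\<sigma>. \<exists>x y. singular_pair U V \<sigma> x y}"
  have "\<forall>\<sigma>\<in>?S. \<exists>x y. singular_pair U V \<sigma> x y" by blast
  then obtain x y where xy: "\<And>\<sigma>. \<sigma> \<in> ?S \<Longrightarrow> singular_pair U V \<sigma> (x \<sigma>) (y \<sigma>)"
    by metis
  have orth: "ip (x \<sigma>) (x \<tau>) = 0" if \<sigma>\<tau>: "\<sigma> \<in> ?S" "\<tau> \<in> ?S" "\<sigma> \<noteq> \<tau>" for \<sigma> \<tau>
  proof -
    note s = xy[OF \<sigma>\<tau>(1), unfolded singular_pair_def] and t = xy[OF \<sigma>\<tau>(2), unfolded singular_pair_def]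
    define a where "a = ip (x \<sigma>) (x \<tau>)"
    define b where "b = ip (y \<sigma>) (y \<tau>)"
    have "ip (x \<tau>) (y \<sigma>) = \<sigma> * ip (x \<tau>) (x \<sigma>)" "ip (y \<sigma>) (x \<tau>) = \<tau> * ip (y \<sigma>) (y \<tau>)"
         "ip (x \<sigma>) (y \<tau>) = \<tau> * ip (x \<sigma>) (x \<tau>)" "ip (y \<tau>) (x \<sigma>) = \<sigma> * ip (y \<tau>) (y \<sigma>)"
      using s t by blast+
    \<comment> \<open>Eliminating \<open>b\<close> leaves
      \<open>(\<sigma>\<^sup>2 - \<tau>\<^sup>2) * a = 0\<close>; distinct nonnegative values have
      distinct squares.\<close>
    then have ab: "\<sigma> * a = \<tau> * b" "\<tau> * a = \<sigma> * b"
      unfolding a_def b_def by (metis ip_commute)+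
    have "\<sigma>\<^sup>2 * a = \<sigma> * (\<tau> * b)"
      using ab(1) by (simp add: power2_eq_square)
    also have "\<dots> = \<tau>\<^sup>2 * a"
      using ab(2) by (simp add: power2_eq_square)
    finally have "(\<sigma>\<^sup>2 - \<tau>\<^sup>2) * a = 0" by (simp add: algebra_simps)
    moreover have "\<sigma>\<^sup>2 \<noteq> \<tau>\<^sup>2" using s t \<sigma>\<tau>(3) by (auto simp: power2_eq_iff_nonneg)
    ultimately show ?thesis by (simp add: a_def)
  qed
  have unit: "ip (x \<sigma>) (x \<sigma>) = 1" if "\<sigma> \<in> ?S" for \<sigma>
    using xy[OF that] by (simp add: singular_pair_def)
  have on: "orthonormal_on ?S x"
    unfolding orthonormal_on_def using orth unit by auto
  show ?thesis
    using finiteI_independent[OF orthonormal_independent[OF on]] orthonormal_inj_on[OF on]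
    by (rule finite_imageD)
qed

lemma singular_pair_value:
  assumes "singular_pair U V \<sigma> x y"
  shows "ip x y = \<sigma>" "0 \<le> \<sigma>" "\<sigma> \<le> 1"
proof -
  show xy: "ip x y = \<sigma>" and "0 \<le> \<sigma>"
    using assms by (simp_all add: singular_pair_def)
  have "ip (x - y) (x - y) = 2 - 2 * \<sigma>"
    using assms xy by (simp add: ip_commute[of y x] singular_pair_def)
  then show "\<sigma> \<le> 1" using ip_nonneg[of "x - y"] by simp
qed

section \<open>The sine of the largest principal angle\<close>

text \<open>Every canonical angle is the arccosine of a singular value, so there are finitely many,
  and principal vectors exist; hence \<open>Max\<close> is attained at a singular pair.\<close>

lemma sin_largest_principal_angle_le:
  assumes U: "subspace U" "1 \<le> dim U" and V: "subspace V" "1 \<le> dim V"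
    and bound: "\<And>\<sigma> x y. singular_pair U V \<sigma> x y \<Longrightarrow> sqrt (1 - \<sigma>\<^sup>2) \<le> B"
  shows "sin (largest_principal_angle M U V) \<le> B"
proof -
  have sub: "canonical_angles M U V \<subseteq> arccos ` {\<sigma>. \<exists>x y. singular_pair U V \<sigma> x y}"
    unfolding canonical_angles_def using principal_vectors_singular_pair[OF U(1) V(1)] by blast
  then have "finite (canonical_angles M U V)"
    using finite_singular_values by (meson finite_imageI finite_subset)
  moreover have "canonical_angles M U V \<noteq> {}"
  proof -
    obtain u v where "principal_vectors M U V u v"
      using principal_vectors_exist[OF U(1) V(1)] .
    then have "arccos (ip (u 1) (v 1)) \<in> canonical_angles M U V"
      unfolding canonical_angles_def using U(2) V(2) by fastforce
    then show ?thesis by blast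
  qed
  ultimately have "largest_principal_angle M U V \<in> canonical_angles M U V"
    unfolding largest_principal_angle_def by (rule Max_in)
  then obtain \<sigma> x y where sp: "singular_pair U V \<sigma> x y" and
    angle: "largest_principal_angle M U V = arccos \<sigma>"
    using sub by blast
  have "sin (arccos \<sigma>) = sqrt (1 - \<sigma>\<^sup>2)"
    using singular_pair_value[OF sp] by (intro sin_arccos) auto
  then show ?thesis using bound[OF sp] angle by simp
qed

text \<open>The Davis--Kahan argument: test \<open>K - K0\<close> with \<open>u\<close> and the component
  \<open>u - \<sigma> v\<close> of \<open>u\<close> orthogonal to \<open>V\<close>, which is \<open>(1 - \<sigma>\<^sup>2) u\<close> after projection onto \<open>U\<close>.\<close>

lemma singular_pair_sin_le:
  assumes e: "eigenbasis K e \<mu>" and f: "eigenbasis K0 f \<kappa>"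
    and m: "1 \<le> m" "m < CARD('n)" and gap: "\<kappa> m < \<mu> (m + 1)"
    and sp: "singular_pair (span (e ` {m + 1..CARD('n)})) (span (f ` {m + 1..CARD('n)})) \<sigma> u v"
    and \<epsilon>: "0 \<le> \<epsilon>" "\<And>w u. \<bar>w \<bullet> ((K - K0) *v u)\<bar> \<le> \<epsilon> * sqrt (ip w w) * sqrt (ip u u)"
  shows "sqrt (1 - \<sigma>\<^sup>2) \<le> \<epsilon> / (\<mu> (m + 1) - \<kappa> m)"
proof -
  let ?J = "{m + 1..CARD('n)}"
  have J: "?J \<subseteq> {1..CARD('n)}" by auto
  note val = singular_pair_value[OF sp]
  have uU: "u \<in> span (e ` ?J)" and vV: "v \<in> span (f ` ?J)"
    and unit: "ip u u = 1" "ip v v = 1"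
    and eu: "\<And>i. i \<in> ?J \<Longrightarrow> ip (e i) v = \<sigma> * ip (e i) u"
    and fv: "\<And>i. i \<in> ?J \<Longrightarrow> ip (f i) u = \<sigma> * ip (f i) v"
    using sp unfolding singular_pair_def by (blast intro: span_base)+
  have eu0: "ip (e i) u = 0" and fv0: "ip (f i) v = 0" if "i \<in> {1..CARD('n)} - ?J" for i
    using ip_span_eigenbasis[OF e J uU, of i] ip_span_eigenbasis[OF f J vV, of i] that by auto
  define w where "w = u - \<sigma> *\<^sub>R v"
  define s where "s = sqrt (1 - \<sigma>\<^sup>2)"
  have ww: "ip w w = 1 - \<sigma>\<^sup>2"
    using unit val by (simp add: w_def ip_commute[of v u] power2_eq_square algebra_simps)
  have "\<sigma>\<^sup>2 \<le> 1" using val by (simp add: power_le_one)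
  then have s: "0 \<le> s" "s\<^sup>2 = 1 - \<sigma>\<^sup>2" by (simp_all add: s_def)
  have fw: "ip (f i) w = 0" if "i \<in> ?J" for i
    using fv[OF that] by (simp add: w_def)
  \<comment> \<open>On \<open>?J\<close> the coefficient of \<open>w\<close> is
    \<open>1 - \<sigma>\<^sup>2\<close> times that of \<open>u\<close>; off \<open>?J\<close> the
    coefficient of \<open>u\<close> vanishes.\<close>
  have "w \<bullet> (K *v u) = (\<Sum>i\<in>{1..CARD('n)}. s\<^sup>2 * (\<mu> i * ip (e i) u * ip (e i) u))"
    unfolding eigenbasis_form[OF e]
  proof (rule sum.cong)
    fix i assume i: "i \<in> {1..CARD('n)}"
    show "\<mu> i * ip (e i) w * ip (e i) u = s\<^sup>2 * (\<mu> i * ip (e i) u * ip (e i) u)"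
    proof (cases "i \<in> ?J")
      case True
      then have "ip (e i) w = s\<^sup>2 * ip (e i) u"
        unfolding s by (simp add: w_def eu power2_eq_square algebra_simps)
      then show ?thesis by simp
    next
      case False
      then show ?thesis using eu0[of i] i by simp
    qed
  qed simp
  also have "\<dots> = s\<^sup>2 * (u \<bullet> (K *v u))"
    by (simp add: eigenbasis_form[OF e] sum_distrib_left)
  finally have "w \<bullet> (K *v u) = s\<^sup>2 * (u \<bullet> (K *v u))" .
  moreover have "\<mu> (m + 1) \<le> u \<bullet> (K *v u)"
    using eigenbasis_form_ge[OF e, of "m + 1" u] eu0 m unit by simp
  ultimately have wKu: "s\<^sup>2 * \<mu> (m + 1) \<le> w \<bullet> (K *v u)"
    by (simp add: mult_left_mono)
  \<comment> \<open>In the basis \<open>f\<close>, the vector \<open>v\<close> lives on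
    \<open>?J\<close> and \<open>w\<close> off it, so the cross term drops out and \<open>u\<close>
    can be replaced by \<open>w\<close> in the form of \<open>K0\<close>.\<close>
  have "w \<bullet> (K0 *v v) = 0"
    unfolding eigenbasis_form[OF f]
  proof (rule sum.neutral, rule ballI)
    fix i assume "i \<in> {1..CARD('n)}"
    then show "\<kappa> i * ip (f i) w * ip (f i) v = 0"
      using fw[of i] fv0[of i] by (cases "i \<in> ?J") auto
  qed
  moreover have "u = w + \<sigma> *\<^sub>R v" by (simp add: w_def)
  ultimately have "w \<bullet> (K0 *v u) = w \<bullet> (K0 *v w)"
    by (metis add.right_neutral inner_add_right inner_scaleR_right matrix_vector_mult_scaleR
        matrix_vector_right_distrib mult_zero_right)
  also have "\<dots> \<le> \<kappa> m * ip w w"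
    using m fw by (intro eigenbasis_form_le[OF f]) auto
  finally have wK0u: "w \<bullet> (K0 *v u) \<le> s\<^sup>2 * \<kappa> m"
    by (simp add: ww s(2) mult.commute)
  have "s\<^sup>2 * (\<mu> (m + 1) - \<kappa> m) \<le> w \<bullet> ((K - K0) *v u)"
    using wKu wK0u by (simp add: matrix_vector_mult_diff_rdistrib inner_diff_right right_diff_distrib)
  also have "\<dots> \<le> \<epsilon> * s"
    using \<epsilon>(2)[of w u] unit by (simp add: ww s_def)
  finally have main: "s * (s * (\<mu> (m + 1) - \<kappa> m)) \<le> s * \<epsilon>"
    by (simp add: power2_eq_square mult_ac)
  \<comment> \<open>For \<open>s = 0\<close> the right side is nonnegative; otherwise one factor
    \<open>s\<close> cancels from \<open>main\<close>.\<close>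
  show ?thesis
  proof (cases "s = 0")
    case True
    then show ?thesis using \<epsilon>(1) gap by (simp add: s_def[symmetric])
  next
    case False
    then have "s * (\<mu> (m + 1) - \<kappa> m) \<le> \<epsilon>"
      using main s(1) by simp
    then show ?thesis
      using gap by (simp add: s_def[symmetric] pos_le_divide_eq)
  qed
qed

section \<open>Perturbation of eigenvalues and persistence of the gap\<close>

text \<open>One form serves both hypotheses: \<open>c = 1\<close> yields Weyl's bound,
  \<open>\<epsilon> = 0\<close> the relative one.\<close>

lemma eigenvalue_perturbation_le:
  assumes e: "eigenbasis K e \<nu>" and f: "eigenbasis L f \<mu>" and j: "j \<in> {1..CARD('n)}"
    and le: "\<And>x. x \<bullet> (L *v x) \<le> c * (x \<bullet> (K *v x)) + \<epsilon> * ip x x" and c: "0 \<le> c"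
  shows "\<mu> j \<le> c * \<nu> j + \<epsilon>"
proof -
  obtain x where x: "ip x x = 1" "x \<bullet> (K *v x) \<le> \<nu> j" "\<mu> j \<le> x \<bullet> (L *v x)"
    using eigenbasis_compare[OF e f j] .
  have "\<mu> j \<le> c * (x \<bullet> (K *v x)) + \<epsilon>"
    using x(1,3) le[of x] by simp
  also have "\<dots> \<le> c * \<nu> j + \<epsilon>"
    using x(2) c by (intro add_right_mono mult_left_mono)
  finally show ?thesis .
qed

text \<open>The bounds give \<open>\<mu> m \<le> (1 + sp) * \<kappa> m\<close> and
  \<open>(1 + sm) * \<kappa> (m + 1) \<le> \<mu> (m + 1)\<close>. The strict step between them is
  split by the sign of \<open>\<kappa> m\<close>, on which clearing the denominators in
  \<open>ratio\<close> depends.\<close>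

lemma relative_bound_gap:
  assumes f: "eigenbasis K0 f \<kappa>" and e: "eigenbasis K e \<mu>"
    and m: "m \<in> {1..CARD('n)}" "m + 1 \<in> {1..CARD('n)}" and gap: "\<kappa> m < \<kappa> (m + 1)"
    and rb: "relative_bound K0 K (\<kappa> m) (\<kappa> (m + 1)) sm sp"
  shows "\<mu> m < \<mu> (m + 1)"
proof -
  have sm: "0 < 1 + sm" "1 + sm \<le> 1 + sp"
    and lo: "\<And>x. (1 + sm) * (x \<bullet> (K0 *v x)) \<le> x \<bullet> (K *v x)"
    and up: "\<And>x. x \<bullet> (K *v x) \<le> (1 + sp) * (x \<bullet> (K0 *v x))"
    and ratio: "ereal ((1 + sp) / (1 + sm)) < ereal (\<kappa> (m + 1)) / ereal (\<kappa> m)"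
    using rb by (auto simp: relative_bound_def)
  have up': "\<mu> m \<le> (1 + sp) * \<kappa> m"
    using eigenvalue_perturbation_le[OF f e m(1), of "1 + sp" 0] up sm by simp
  \<comment> \<open>The lower bound on \<open>K\<close> is read as an upper bound on
    \<open>K0\<close>, with the roles of the pencils exchanged.\<close>
  have "\<kappa> (m + 1) \<le> (1 / (1 + sm)) * \<mu> (m + 1)"
    using eigenvalue_perturbation_le[OF e f m(2), of "1 / (1 + sm)" 0] lo sm
    by (simp add: field_simps)
  then have lo': "(1 + sm) * \<kappa> (m + 1) \<le> \<mu> (m + 1)"
    using sm by (simp add: field_simps)
  have "(1 + sp) * \<kappa> m < (1 + sm) * \<kappa> (m + 1)"
  proof (cases "\<kappa> m" "0::real" rule: linorder_cases)
    case less
    \<comment> \<open>\<open>K0\<close> is negative on \<open>f m\<close>, so that the two-sided bound forces \<open>sm = sp\<close>.\<close>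
    have "f m \<bullet> (K0 *v f m) = \<kappa> m"
      using eigenbasis_ip_mult[OF f m(1), of "f m"]
        orthonormal_onD[OF eigenbasis_orthonormal[OF f] m(1) m(1)] by simp
    then have "(1 + sm) * \<kappa> m \<le> (1 + sp) * \<kappa> m"
      using lo[of "f m"] up[of "f m"] by simp
    then have "1 + sp = 1 + sm"
      using less sm by (simp add: mult_le_cancel_right)
    then show ?thesis using gap sm by simp
  next
    case equal
    then show ?thesis using gap sm by simp
  next
    case greater
    then have "(1 + sp) / (1 + sm) < \<kappa> (m + 1) / \<kappa> m"
      using ratio by simp
    then show ?thesis using greater sm by (simp add: field_simps)
  qed
  then show ?thesis using up' lo' by linarith
qed

end

section \<open>The selected modes and the final assembly\<close>

text \<open>Monotonicity puts the top \<open>k\<close> modes at or above the cutoff, and the strict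
  gap excludes a tie with mode \<open>N - k\<close> or any below it.\<close>

lemma card_selected_modes:
  assumes k: "1 \<le> k" "k < N" and h: "0 < h"
    and mono: "mono_on {1..N} om" and gap: "om (N - k) < om (N - k + 1)"
  shows "card (selected_modes h om N (cutoff h om N k)) = k"
proof -
  have "selected_modes h om N (cutoff h om N k) = {N - k + 1..N}"
  proof (intro set_eqI iffI)
    fix j assume "j \<in> selected_modes h om N (cutoff h om N k)"
    then have j: "j \<in> {1..N}" "om (N - k + 1) \<le> om j"
      using h by (auto simp: selected_modes_def cutoff_def)
    have "\<not> j \<le> N - k"
      using mono_onD[OF mono j(1), of "N - k"] k gap j(2) by force
    then show "j \<in> {N - k + 1..N}" using j by auto
  next
    fix j assume "j \<in> {N - k + 1..N}"
    then show "j \<in> selected_modes h om N (cutoff h om N k)"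
      using h k mono_onD[OF mono, of "N - k + 1" j] by (auto simp: selected_modes_def cutoff_def)
  qed
  then show ?thesis using k by simp
qed

theorem proposition5p19:
  fixes M K0 K :: "real^'n^'n" and k N :: nat
    and lam mu :: "nat \<Rightarrow> real" and gam eps :: real
  assumes "spd_matrix M" and "symmetric_matrix K0" and "symmetric_matrix K"
    and "N = CARD('n)" and "1 \<le> k" and "k < N"
    and "lam = gen_eigenvalue K0 M" and "mu = gen_eigenvalue K M"
    and "gam = lam (N - k + 1) - lam (N - k)" and "0 < gam"
    and "eps = spectral_norm (inv_sqrt_matrix M ** (K - K0) ** inv_sqrt_matrix M)"
  shows "(2 * eps < gam \<or> (\<exists>sm sp. relative_bound K0 K (lam (N - k)) (lam (N - k + 1)) sm sp) \<longrightarrow>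
            0 < mu (N - k + 1) - mu (N - k) \<and>
            (\<forall>h om. 0 < h \<and> (\<forall>j\<in>{1..N}. 0 \<le> om j \<and> (om j)\<^sup>2 = mu j) \<longrightarrow>
                card (selected_modes h om N (cutoff h om N k)) = k)) \<and>
         (2 * eps < gam \<longrightarrow>
            dim (outlier_eigenspace K M k) = k \<and> dim (outlier_eigenspace K0 M k) = k \<and>
            sin (largest_principal_angle M (outlier_eigenspace K M k) (outlier_eigenspace K0 M k))
              \<le> eps / (gam - eps))"
proof -
  interpret spd_form M by standard fact
  obtain f \<kappa> where f: "eigenbasis K0 f \<kappa>" using eigenbasis_exists[OF assms(2)] .
  obtain e \<mu> where e: "eigenbasis K e \<mu>" using eigenbasis_exists[OF assms(3)] .
  \<comment> \<open>\<open>m\<close> is the last mode below the outliers; \<open>k < N\<close> makes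
    it at least \<open>1\<close>.\<close>
  define m where "m = N - k"
  have m: "m \<in> {1..CARD('n)}" "m + 1 \<in> {1..CARD('n)}" "1 \<le> m" "m < CARD('n)"
    and mk: "N - k = m" "N - k + 1 = m + 1" "CARD('n) - k = m" "CARD('n) - k + 1 = m + 1"
    using assms(4-6) by (auto simp: m_def)
  have lam: "lam m = \<kappa> m" "lam (m + 1) = \<kappa> (m + 1)"
    unfolding assms(7) using gen_eigenvalue_eq[OF f] m by auto
  have mu: "mu j = \<mu> j" if "j \<in> {1..N}" for j
    unfolding assms(8) using gen_eigenvalue_eq[OF e] that assms(4) by auto
  have mu_m: "mu m = \<mu> m" "mu (m + 1) = \<mu> (m + 1)"
    using mu m assms(4) by auto
  have gam: "gam = \<kappa> (m + 1) - \<kappa> m"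
    using assms(9) unfolding mk lam .
  then have gap0: "\<kappa> m < \<kappa> (m + 1)" using assms(10) by simp
  have eps: "\<bar>w \<bullet> ((K - K0) *v u)\<bar> \<le> eps * sqrt (ip w w) * sqrt (ip u u)" for w u
    unfolding assms(11) by (rule form_le_spectral_norm)
  have eps0: "0 \<le> eps"
    unfolding assms(11) spectral_norm_def by (rule onorm_pos_le[OF matrix_vector_mul_bounded_linear])
  have diff: "\<bar>x \<bullet> (K *v x) - x \<bullet> (K0 *v x)\<bar> \<le> eps * ip x x" for x
    using eps[of x x] ip_nonneg[of x]
    by (simp add: matrix_vector_mult_diff_rdistrib inner_diff_right mult.assoc)
  have Weyl: "\<mu> j \<le> \<kappa> j + eps" "\<kappa> j \<le> \<mu> j + eps" if j: "j \<in> {1..CARD('n)}" for j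
    using eigenvalue_perturbation_le[OF f e j, of 1 eps] eigenvalue_perturbation_le[OF e f j, of 1 eps]
      diff by (simp_all add: abs_le_iff algebra_simps)
  \<comment> \<open>Each end of the gap moves by at most \<open>eps\<close>, which leaves at least
    \<open>gam - 2 * eps\<close>.\<close>
  have gap_i: "\<mu> m < \<mu> (m + 1)" if "2 * eps < gam"
    using Weyl(1)[OF m(1)] Weyl(2)[OF m(2)] that gam by simp
  have gap: "\<mu> m < \<mu> (m + 1)"
    if "2 * eps < gam \<or> (\<exists>sm sp. relative_bound K0 K (lam m) (lam (m + 1)) sm sp)"
    using that gap_i relative_bound_gap[OF f e m(1,2) gap0] unfolding lam by blast
  have modes: "card (selected_modes h om N (cutoff h om N k)) = k"
    if gap: "\<mu> m < \<mu> (m + 1)" and h: "0 < h" and om: "\<forall>j\<in>{1..N}. 0 \<le> om j \<and> (om j)\<^sup>2 = mu j" for h om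
  proof (rule card_selected_modes[OF assms(5,6) h])
    \<comment> \<open>Nonnegativity makes \<open>om j\<close> the root of \<open>\<mu> j\<close>,
      and the strictly increasing root carries order and gap over to the frequencies.\<close>
    have om_sqrt: "om j = sqrt (\<mu> j)" if "j \<in> {1..N}" for j
      using om mu[OF that] that by (metis real_sqrt_unique)
    show "mono_on {1..N} om"
      by (rule mono_onI)
        (simp only: om_sqrt real_sqrt_le_iff, rule eigenbasis_mono[OF e], simp_all only: assms(4))
    show "om (N - k) < om (N - k + 1)"
      unfolding mk using om_sqrt[of m] om_sqrt[of "m + 1"] m gap assms(4) by simp
  qed
  have angle: "dim (outlier_eigenspace K M k) = k \<and> dim (outlier_eigenspace K0 M k) = k \<and>
      sin (largest_principal_angle M (outlier_eigenspace K M k) (outlier_eigenspace K0 M k))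
        \<le> eps / (gam - eps)" if small: "2 * eps < gam"
  proof -
    let ?J = "{m + 1..CARD('n)}"
    note kN = assms(5) assms(6)[unfolded assms(4)]
    have U: "outlier_eigenspace K M k = span (e ` ?J)"
      using outlier_eigenspace_eq[OF e kN] gap_i[OF small] unfolding mk by simp
    have V: "outlier_eigenspace K0 M k = span (f ` ?J)"
      using outlier_eigenspace_eq[OF f kN] gap0 unfolding mk by simp
    have "card ?J = k" using mk(3) kN by auto
    then have dims: "dim (span (e ` ?J)) = k" "dim (span (f ` ?J)) = k"
      using dim_span_eigenbasis[OF e, of ?J] dim_span_eigenbasis[OF f, of ?J] by auto
    have "sin (largest_principal_angle M (span (e ` ?J)) (span (f ` ?J))) \<le> eps / (gam - eps)"
    proof (rule sin_largest_principal_angle_le)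
      fix \<sigma> u v assume sp: "singular_pair (span (e ` ?J)) (span (f ` ?J)) \<sigma> u v"
      \<comment> \<open>Only one end of this mixed gap is perturbed, hence a loss of
        \<open>eps\<close> rather than \<open>2 * eps\<close>.\<close>
      have sep: "gam - eps \<le> \<mu> (m + 1) - \<kappa> m"
        using Weyl(2)[OF m(2)] gam by simp
      have "\<kappa> m < \<mu> (m + 1)"
        using sep small eps0 by linarith
      then have "sqrt (1 - \<sigma>\<^sup>2) \<le> eps / (\<mu> (m + 1) - \<kappa> m)"
        using singular_pair_sin_le[OF e f m(3,4) _ sp eps0 eps] by blast
      \<comment> \<open>\<open>2 * eps < gam\<close> and \<open>0 \<le> eps\<close> make
        \<open>gam - eps\<close> positive, so passing to this smaller denominator cannot decrease
        the quotient.\<close>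
      also have "\<dots> \<le> eps / (gam - eps)"
        using sep small eps0 by (intro divide_left_mono mult_pos_pos) auto
      finally show "sqrt (1 - \<sigma>\<^sup>2) \<le> eps / (gam - eps)" .
    qed (use dims assms(5) in auto)
    then show ?thesis unfolding U V using dims by blast
  qed
  show ?thesis
    unfolding mk mu_m using gap modes angle by auto
qed

end
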